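(* Let $c=(c_1,\dots,c_r)$ be a fixed profile, and let $\mathcal{P}_c$ be the set of all cylindric partitions with profile $c$. Then, as formal power series in $q$ with coefficients in $\mathbb{Z}[z,u]$, $$\sum_{\Lambda \in \mathcal{P}_c} q^{|\Lambda|} z^{\max(\Lambda)} u^{\mathrm{st}(\Lambda)} = \frac{((1-u)zq;q)_\infty}{(zq;q)_\infty}\left[1+\sum_{m\ge 1}\ \sum_{\Pi_1<\Pi_2<\cdots<\Pi_m}\ \prod_{j=1}^m \frac{uzq^{|\Pi_j|}}{1-(1-u)zq^{|\Pi_j|}}\right],$$ where the innermost sum on the right-hand side is over all possible chains $\Pi_1<\Pi_2<\cdots<\Pi_m$ of $m$ pivots for the profile $c$.
   Context: **Cylindric partitions.** Let $r,\ell\ge 1$ be integers and let $c=(c_1,\dots,c_r)$ be a composition (tuple of nonnegative integers, zeros allowed) with $c_1+\cdots+c_r=\ell$. A cylindric partition with profile $c$ is an $r$-tuple $\Lambda=(\lambda^{(1)},\dots,\lambda^{(r)})$ of integer partitions (weakly decreasing finite sequences of positive integers, where missing entries are regarded as $0$) such that for all $j\ge1$ and $1\le i\le r-1$, $\lambda^{(i)}_j\ge\lambda^{(i+1)}_{j+c_{i+1}}$, and for all $j\ge 1$, $\lambda^{(r)}_j\ge\lambda^{(1)}_{j+c_1}$. $|\Lambda|$ is the sum of all parts of all $\lambda^{(i)}$; $\max(\Lambda)$ is the largest part appearing in $\Lambda$ ($0$ if $\Lambda$ is empty); $\mathrm{st}(\Lambda)$ is the number of distinct positive integers appearing as parts in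 $\Lambda$. **Notation.** $(a;q)_\infty=\prod_{j\ge1}(1-aq^{j-1})$. **Slices.** A slice of profile $c$ is a cylindric partition of profile $c$ all of whose parts equal $1$; it is determined by its row lengths $(n_1,\dots,n_r)$, and its weight is $n_1+\cdots+n_r$. Put $\beta_0=(\beta_{0,1},\dots,\beta_{0,r})$ with $\beta_{0,i}=c_1+\sum_{k=i+1}^{r}c_k$ (so $\beta_{0,1}=\ell$ and $\beta_{0,r}=c_1$). The slice with row lengths $(n_1,\dots,n_r)$ is identified with the skew diagram $\beta\setminus\beta_0$ where $\beta=(\beta_{0,1}+n_1,\dots,\beta_{0,r}+n_r)$, which is a partition with $r$ parts (zeros allowed). The weight of a slice is also written $|\beta\setminus\beta_0|$, the number of its boxes. Slices are partially ordered by inclusion, and $<$ denotes strict inclusion. The empty slice is $E=\beta_0\setminus\beta_0$. Every $\Lambda$ is uniquely a sum of a weakly decreasing chain of $\max(\Lambda)$ nonempty slices (its horizontal slices: the level-$h$ slice has row lengths $\#\{j:\lambda^{(i)}_j\ge h\}$); the distinct nonempty slices occurring form a strict chain. **Pivots.** Let $\beta_1\setminus\beta_0<\beta_2\setminus\beta_0<\cdots<\beta_s\setminus\beta_0$ be a strict chain of nonempty slices of profile $c$. Let $\beta_{s+1}$ be obtained from $\beta_s$ by adding $1$ to each of its $r$ parts (zero parts included). Align all Young diagrams at their left and top edges, so column numbers are the ordinary ones. For $1\le j\le s$, the slice $\beta_j\setminus\beta_0$ is called a pivot in the chain if the rightmost column of the skew diagram $\beta_j\setminus\beta_{j-1}$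 is strictly to the right of the leftmost column of the skew diagram $\beta_{j+1}\setminus\beta_j$. A chain of $m$ pivots $\Pi_1<\cdots<\Pi_m$ for the profile $c$ is a strict chain of slices that is the complete list of pivots of some finite strict chain of nonempty slices of profile $c$ (equivalently, the complete list of pivots of the chain of distinct nonempty slices of some $\Lambda\in\mathcal{P}_c$). *)

theory Defs
  imports
    "HOL-Analysis.Analysis"
    "HOL-Library.More_List"
begin

section \<open>Cylindric partitions\<close>

text \<open>
  A profile is a nonempty list of natural numbers with positive sum. All indices are shifted by
  one with respect to the usual mathematical notation: \<open>c ! i\<close> is $c_{i+1}$,
  \<open>\<Lambda> ! i\<close> is $\lambda^{(i+1)}$, and \<open>nth_default 0 (\<Lambda> ! i) j\<close> is
  $\lambda^{(i+1)}_{j+1}$, where missing entries count as 0.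
\<close>

definition integer_partition :: "nat list \<Rightarrow> bool" where
  "integer_partition \<mu> \<longleftrightarrow> sorted_wrt (\<ge>) \<mu> \<and> (\<forall>p\<in>set \<mu>. p > 0)"

definition cylindric_partition :: "nat list \<Rightarrow> nat list list \<Rightarrow> bool" where
  "cylindric_partition c \<Lambda> \<longleftrightarrow>
     length \<Lambda> = length c \<and>
     (\<forall>\<mu>\<in>set \<Lambda>. integer_partition \<mu>) \<and>
     (\<forall>i j. Suc i < length c \<longrightarrow>
        nth_default 0 (\<Lambda> ! i) j \<ge> nth_default 0 (\<Lambda> ! Suc i) (j + c ! Suc i)) \<and>
     (\<forall>j. nth_default 0 (\<Lambda> ! (length c - 1)) j \<ge> nth_default 0 (\<Lambda> ! 0) (j + c ! 0))"

definition cylindric_partitions :: "nat list \<Rightarrow> nat list list set" where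
  "cylindric_partitions c = {\<Lambda>. cylindric_partition c \<Lambda>}"

definition parts :: "nat list list \<Rightarrow> nat set" where
  "parts \<Lambda> = (\<Union>\<mu>\<in>set \<Lambda>. set \<mu>)"

definition weight :: "nat list list \<Rightarrow> nat" where
  "weight \<Lambda> = sum_list (map sum_list \<Lambda>)"

definition max_part :: "nat list list \<Rightarrow> nat" where
  "max_part \<Lambda> = (if parts \<Lambda> = {} then 0 else Max (parts \<Lambda>))"

definition st :: "nat list list \<Rightarrow> nat" where
  "st \<Lambda> = card (parts \<Lambda>)"


section \<open>Slices and pivots\<close>

definition slice :: "nat list \<Rightarrow> nat list list \<Rightarrow> bool" where
  "slice c \<sigma> \<longleftrightarrow> cylindric_partition c \<sigma> \<and> (\<forall>p\<in>parts \<sigma>. p = 1)"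

definition empty_slice :: "nat list \<Rightarrow> nat list list" where
  "empty_slice c = replicate (length c) []"

text \<open>Inclusion is inclusion of the diagrams; only meant for slices of the same profile.\<close>

definition slice_less :: "nat list list \<Rightarrow> nat list list \<Rightarrow> bool" where
  "slice_less \<sigma> \<sigma>' \<longleftrightarrow> list_all2 (\<lambda>\<mu> \<nu>. length \<mu> \<le> length \<nu>) \<sigma> \<sigma>' \<and> \<sigma> \<noteq> \<sigma>'"

definition strict_slice_chain :: "nat list \<Rightarrow> nat list list list \<Rightarrow> bool" where
  "strict_slice_chain c S \<longleftrightarrow>
     (\<forall>\<sigma>\<in>set S. slice c \<sigma> \<and> \<sigma> \<noteq> empty_slice c) \<and> sorted_wrt slice_less S"

definition beta0 :: "nat list \<Rightarrow> nat list" where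
  "beta0 c = map (\<lambda>i. c ! 0 + (\<Sum>k=Suc i..<length c. c ! k)) [0..<length c]"

definition beta :: "nat list \<Rightarrow> nat list list \<Rightarrow> nat list" where
  "beta c \<sigma> = map2 (+) (beta0 c) (map length \<sigma>)"

text \<open>
  For a chain \<open>S = [\<beta>\<^sub>1 - \<beta>\<^sub>0, \<dots>, \<beta>\<^sub>s - \<beta>\<^sub>0]\<close>
  of \<open>s \<ge> 1\<close> slices, \<open>chain_beta c S j\<close> is \<open>\<beta>\<^sub>j\<close>
  for \<open>0 \<le> j \<le> s + 1\<close>.
\<close>

definition chain_beta :: "nat list \<Rightarrow> nat list list list \<Rightarrow> nat \<Rightarrow> nat list" where
  "chain_beta c S j =
     (if j = 0 then beta0 c
      else if j \<le> length S then beta c (S ! (j - 1))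
      else map Suc (beta c (last S)))"

text \<open>Columns are numbered from 1; row \<open>i\<close> of the skew diagram occupies the columns
  \<open>\<alpha> ! i + 1, \<dots>, \<beta> ! i\<close>.\<close>

definition skew_columns :: "nat list \<Rightarrow> nat list \<Rightarrow> nat set" where
  "skew_columns \<beta> \<alpha> = (\<Union>i<length \<beta>. {\<alpha> ! i<..\<beta> ! i})"

text \<open>The index \<open>j\<close> of a slice in the chain runs over \<open>1, \<dots>, length S\<close>. Both sets
  of columns are then finite and nonempty.\<close>

definition is_pivot :: "nat list \<Rightarrow> nat list list list \<Rightarrow> nat \<Rightarrow> bool" where
  "is_pivot c S j \<longleftrightarrow>
     Max (skew_columns (chain_beta c S j) (chain_beta c S (j - 1)))
       > Min (skew_columns (chain_beta c S (j + 1)) (chain_beta c S j))"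

definition pivots :: "nat list \<Rightarrow> nat list list list \<Rightarrow> nat list list list" where
  "pivots c S = map (\<lambda>j. S ! (j - 1)) (filter (is_pivot c S) [1..<Suc (length S)])"

definition pivot_chains :: "nat list \<Rightarrow> nat \<Rightarrow> nat list list list set" where
  "pivot_chains c m = {P. length P = m \<and> (\<exists>S. strict_slice_chain c S \<and> pivots c S = P)}"


section \<open>Formal power series in \<open>q\<close> over \<open>\<int>[z, u]\<close>\<close>

text \<open>The ring $\mathbb{Z}[z,u]$ is taken as $\mathbb{Z}[z][u]$, the type \<^typ>\<open>int poly poly\<close>.\<close>

type_synonym zu_fps = "int poly poly fps"

definition zvar :: zu_fps where "zvar = fps_const [:[:0, 1:]:]"

definition uvar :: zu_fps where "uvar = fps_const [:0, 1:]"

abbreviation qvar :: zu_fps where "qvar \<equiv> fps_X"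

text \<open>The coefficient ring is not a field, so division of power series in the library's sense
  is not available; this is the inverse of a series with constant coefficient 1.\<close>

definition fps_recip :: "'a::comm_ring_1 fps \<Rightarrow> 'a fps" where
  "fps_recip f = fps_right_inverse f 1"

text \<open>The infinite product $(a;q)_\infty$. Convergence of products and sums refers to the
  library's metric on \<^typ>\<open>'a fps\<close>, i.e. coefficientwise stabilisation.\<close>

definition qpoch_inf :: "'a::comm_ring_1 fps \<Rightarrow> 'a fps" where
  "qpoch_inf a = prodinf (\<lambda>j. 1 - a * fps_X ^ j)"

abbreviation (input) pivot_term :: "nat \<Rightarrow> nat list list list \<Rightarrow> zu_fps" where
  "pivot_term m P \<equiv>
     (\<Prod>j<m. uvar * zvar * qvar ^ weight (P ! j) *
        fps_recip (1 - (1 - uvar) * zvar * qvar ^ weight (P ! j)))"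


section \<open>The series, products and inverses are well defined\<close>

lemma fps_mult_recip: "fps_nth f 0 = 1 \<Longrightarrow> f * fps_recip f = 1"
  unfolding fps_recip_def by (rule fps_right_inverse) simp

lemma fps_has_sumI:
  fixes f :: "'a \<Rightarrow> 'b::comm_ring_1 fps"
  assumes fin: "\<And>n. finite {x\<in>A. fps_nth (f x) n \<noteq> 0}"
  shows "(f has_sum Abs_fps (\<lambda>n. \<Sum>x | x \<in> A \<and> fps_nth (f x) n \<noteq> 0. fps_nth (f x) n)) A"
  unfolding has_sum_def tendsto_fps_iff
proof
  fix n
  let ?X = "{x\<in>A. fps_nth (f x) n \<noteq> 0}"
  have "\<forall>\<^sub>F F in finite_subsets_at_top A. finite F \<and> ?X \<subseteq> F \<and> F \<subseteq> A"
    using fin[of n] by (subst eventually_finite_subsets_at_top) (intro exI[of _ ?X], auto)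
  then show "\<forall>\<^sub>F F in finite_subsets_at_top A. fps_nth (sum f F) n =
      fps_nth (Abs_fps (\<lambda>n. \<Sum>x | x \<in> A \<and> fps_nth (f x) n \<noteq> 0. fps_nth (f x) n)) n"
  proof eventually_elim
    case (elim F)
    have "(\<Sum>x\<in>?X. fps_nth (f x) n) = (\<Sum>x\<in>F. fps_nth (f x) n)"
      using elim by (intro sum.mono_neutral_left) auto
    then show ?case by (simp add: fps_sum_nth)
  qed
qed

lemma finite_tuples_weight_le:
  "finite {\<Lambda>. length \<Lambda> = r \<and> (\<forall>\<mu>\<in>set \<Lambda>. integer_partition \<mu>) \<and> weight \<Lambda> \<le> n}"
proof (rule finite_subset)
  let ?R = "{\<mu>. set \<mu> \<subseteq> {..n} \<and> length \<mu> \<le> n}"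
  show "finite {\<Lambda>. set \<Lambda> \<subseteq> ?R \<and> length \<Lambda> = r}"
    by (intro finite_lists_length_eq finite_lists_length_le) simp
  show "{\<Lambda>. length \<Lambda> = r \<and> (\<forall>\<mu>\<in>set \<Lambda>. integer_partition \<mu>) \<and> weight \<Lambda> \<le> n}
          \<subseteq> {\<Lambda>. set \<Lambda> \<subseteq> ?R \<and> length \<Lambda> = r}"
  proof (safe, goal_cases)
    case (1 \<Lambda> \<mu> p)
    have "sum_list \<mu> \<le> weight \<Lambda>" unfolding weight_def using 1 by (intro member_le_sum_list) auto
    moreover have "p \<le> sum_list \<mu>" using 1 by (intro member_le_sum_list) auto
    ultimately show ?case using 1 by simp
  next
    case (2 \<Lambda> \<mu>)
    have "sum_list \<mu> \<le> weight \<Lambda>" unfolding weight_def using 2 by (intro member_le_sum_list) auto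
    moreover have "length \<mu> = (\<Sum>p\<leftarrow>\<mu>. 1)" by (simp add: sum_list_triv)
    moreover have "(\<Sum>p\<leftarrow>\<mu>. 1) \<le> (\<Sum>p\<leftarrow>\<mu>. p)"
      using 2 by (intro sum_list_mono) (auto simp: integer_partition_def Suc_le_eq)
    ultimately show ?case using 2 by simp
  qed
qed

lemma cylindric_term_summable:
  "(\<lambda>\<Lambda>. qvar ^ weight \<Lambda> * zvar ^ max_part \<Lambda> * uvar ^ st \<Lambda>) summable_on cylindric_partitions c"
  (is "?f summable_on _")
proof -
  have "finite {\<Lambda>\<in>cylindric_partitions c. fps_nth (?f \<Lambda>) n \<noteq> 0}" for n
    by (rule finite_subset[OF _ finite_tuples_weight_le[of "length c" n]])
       (auto simp: cylindric_partitions_def cylindric_partition_def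
          mult.assoc fps_X_power_mult_nth split: if_splits)
  then show ?thesis
    using fps_has_sumI[of "cylindric_partitions c" ?f] unfolding summable_on_def by blast
qed

lemma pivot_chain_slice:
  assumes "P \<in> pivot_chains c m" "\<sigma> \<in> set P"
  shows "slice c \<sigma>" "weight \<sigma> > 0"
proof -
  obtain S where S: "strict_slice_chain c S" "pivots c S = P"
    using assms(1) by (auto simp: pivot_chains_def)
  then obtain j where "1 \<le> j" "j \<le> length S" "\<sigma> = S ! (j - 1)"
    using assms(2) by (auto simp: pivots_def)
  then have "\<sigma> \<in> set S" by simp
  then have *: "slice c \<sigma>" "\<sigma> \<noteq> empty_slice c" using S by (auto simp: strict_slice_chain_def)
  show "slice c \<sigma>" by fact
  show "weight \<sigma> > 0"
  proof (rule ccontr)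
    assume "\<not> weight \<sigma> > 0"
    then have "\<forall>\<mu>\<in>set \<sigma>. \<forall>p\<in>set \<mu>. p = 0" by (simp add: weight_def)
    then have "\<forall>\<mu>\<in>set \<sigma>. \<mu> = []"
      using * by (metis cylindric_partition_def integer_partition_def less_irrefl
          list.set_intros(1) neq_Nil_conv slice_def)
    then have "\<sigma> = empty_slice c"
      using * by (auto simp: empty_slice_def slice_def cylindric_partition_def
          intro: replicate_eqI)
    with * show False by simp
  qed
qed

lemma pivot_term_nth_eq_0:
  assumes "n < (\<Sum>j<m. weight (P ! j))"
  shows "fps_nth (pivot_term m P) n = 0"
proof -
  have "pivot_term m P = qvar ^ (\<Sum>j<m. weight (P ! j)) *
     (\<Prod>j<m. uvar * zvar * fps_recip (1 - (1 - uvar) * zvar * qvar ^ weight (P ! j)))"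
    unfolding power_sum prod.distrib[symmetric]
    by (intro prod.cong) (simp_all add: mult_ac)
  then show ?thesis using assms by (simp add: fps_X_power_mult_nth)
qed

lemma pivot_term_finite: "finite {P\<in>pivot_chains c m. fps_nth (pivot_term m P) n \<noteq> 0}"
proof (rule finite_subset)
  let ?R = "{\<Lambda>. length \<Lambda> = length c \<and> (\<forall>\<mu>\<in>set \<Lambda>. integer_partition \<mu>) \<and> weight \<Lambda> \<le> n}"
  show "finite {P. set P \<subseteq> ?R \<and> length P = m}"
    by (intro finite_lists_length_eq finite_tuples_weight_le)
  show "{P\<in>pivot_chains c m. fps_nth (pivot_term m P) n \<noteq> 0} \<subseteq> {P. set P \<subseteq> ?R \<and> length P = m}"
  proof clarify
    fix P assume P: "P \<in> pivot_chains c m" "fps_nth (pivot_term m P) n \<noteq> 0"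
    then have le: "(\<Sum>j<m. weight (P ! j)) \<le> n"
      using pivot_term_nth_eq_0 leI by blast
    have "\<sigma> \<in> ?R" if \<sigma>: "\<sigma> \<in> set P" for \<sigma>
    proof -
      have "length P = m" using P by (simp add: pivot_chains_def)
      then obtain j where j: "j < m" "\<sigma> = P ! j" using \<sigma> by (auto simp: in_set_conv_nth)
      have "weight (P ! j) \<le> (\<Sum>j<m. weight (P ! j))"
        using j by (intro member_le_sum) auto
      then show ?thesis using le j pivot_chain_slice[OF P(1) \<sigma>]
        by (auto simp: slice_def cylindric_partition_def)
    qed
    then show "set P \<subseteq> ?R \<and> length P = m" using P by (auto simp: pivot_chains_def)
  qed
qed

lemma pivot_term_summable: "pivot_term m summable_on pivot_chains c m"
  using fps_has_sumI[OF pivot_term_finite] unfolding summable_on_def by blast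

lemma pivot_sum_summable:
  "(\<lambda>m. infsum (pivot_term m) (pivot_chains c m)) summable_on {1..}"
proof -
  have "fps_nth (infsum (pivot_term m) (pivot_chains c m)) n = 0" if "n < m" for m n
  proof -
    have "fps_nth (pivot_term m P) n = 0" if P: "P \<in> pivot_chains c m" for P
    proof (rule pivot_term_nth_eq_0)
      have "length P = m" using P by (auto simp: pivot_chains_def)
      moreover have "(\<Sum>j<length P. 1) \<le> (\<Sum>j<length P. weight (P ! j))"
        using pivot_chain_slice(2)[OF P] by (intro sum_mono) (auto simp: Suc_le_eq)
      ultimately show "n < (\<Sum>j<m. weight (P ! j))" using \<open>n < m\<close> by simp
    qed
    then have "{P\<in>pivot_chains c m. fps_nth (pivot_term m P) n \<noteq> 0} = {}" by blast
    then show ?thesis by (simp only: infsumI[OF fps_has_sumI[OF pivot_term_finite]] fps_nth_Abs_fps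
      sum.empty)
  qed
  then have "finite {m\<in>{1..}. fps_nth (infsum (pivot_term m) (pivot_chains c m)) n \<noteq> 0}" for n
    by (intro finite_subset[OF _ finite_atMost[of n]]) (auto simp: not_less[symmetric])
  then show ?thesis using fps_has_sumI[of "{1..}" "\<lambda>m. infsum (pivot_term m) (pivot_chains c m)"] unfolding summable_on_def by blast
qed

lemma qpoch_inf_convergent:
  fixes a :: "'a::comm_ring_1 fps"
  assumes "fps_nth a 0 = 0"
  shows "(\<lambda>j. 1 - a * fps_X ^ j) has_prod qpoch_inf a" and "fps_nth (qpoch_inf a) 0 = 1"
proof -
  define p where "p n = (\<Prod>i\<le>n. 1 - a * fps_X ^ i)" for n
  have p0: "fps_nth (p n) 0 = 1" for n
    using assms by (induction n) (simp_all add: p_def)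
  have step: "fps_nth (p (Suc n)) k = fps_nth (p n) k" if "k \<le> n" for n k
  proof -
    have "p (Suc n) = p n - fps_X ^ Suc n * (a * p n)" by (simp add: p_def algebra_simps)
    then show ?thesis using that by (simp only: fps_sub_nth fps_X_power_mult_nth) simp
  qed
  have stable: "fps_nth (p n) k = fps_nth (p k) k" if "k \<le> n" for n k
    using that by (induction n rule: dec_induct) (auto simp: step)
  define L where "L = Abs_fps (\<lambda>k. fps_nth (p k) k)"
  have "p \<longlonglongrightarrow> L"
    unfolding tendsto_fps_iff
  proof
    fix k
    show "\<forall>\<^sub>F n in sequentially. fps_nth (p n) k = fps_nth L k"
      using eventually_ge_at_top[of k] by eventually_elim
        (simp only: L_def fps_nth_Abs_fps, erule stable)
  qed
  moreover have "L \<noteq> 0" using p0[of 0] by (metis L_def fps_nth_Abs_fps fps_zero_nth zero_neq_one)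
  ultimately have "raw_has_prod (\<lambda>j. 1 - a * fps_X ^ j) 0 L"
    by (simp add: raw_has_prod_def p_def[abs_def])
  then have L: "(\<lambda>j. 1 - a * fps_X ^ j) has_prod L" by (simp add: has_prod_def)
  have uniq: "L' = L" if "(\<lambda>j. 1 - a * fps_X ^ j) has_prod L'" for L'
  proof -
    have "1 - a * fps_X ^ i \<noteq> 0" for i
    proof
      assume "1 - a * fps_X ^ i = 0"
      then have "fps_nth (1 - a * fps_X ^ i) 0 = 0" by simp
      then show False using assms by simp
    qed
    then have "raw_has_prod (\<lambda>j. 1 - a * fps_X ^ j) 0 L'"
      using that by (auto simp: has_prod_def)
    then have "p \<longlonglongrightarrow> L'" by (simp add: raw_has_prod_def p_def[abs_def])
    then show ?thesis using \<open>p \<longlonglongrightarrow> L\<close> LIMSEQ_unique by blast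
  qed
  have eq: "qpoch_inf a = L"
    unfolding qpoch_inf_def prodinf_def by (rule the_equality, rule L, erule uniq)
  show "(\<lambda>j. 1 - a * fps_X ^ j) has_prod qpoch_inf a"
    unfolding eq by (rule L)
  show "fps_nth (qpoch_inf a) 0 = 1"
    unfolding eq L_def fps_nth_Abs_fps by (rule p0)
qed

end

theory Submission
  imports Defs
begin

text \<open>
  Label every box by its column and call a slice $\sigma$ of a chain a pivot if the labels have a
  descent at $\sigma$. This behaves like an edge labelling of the graded poset of slices: between
  slices $\alpha < \tau$ there is exactly one slice of each intermediate weight at which the
  labels do not descend, and inserting or deleting it does not affect the other pivots. Hence a
  chain is determined by its pivots $P$ together with the set $N$ of the weights of its slices,
  and every finite $N$ containing the weights of $P$ occurs.

  Removing the lowest level of a cylindric partition turns the left-hand side into the sum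
  over all chains of $\prod g(|\sigma|)$ with $g(n) = uzq^n / (1 - zq^n)$. Grouping by pivots,
  each weight outside $P$ contributes a factor $1 + g(n) = (1 - (1-u)zq^n)/(1 - zq^n)$, and a pivot
  contributes $g(n) = (1 + g(n)) \cdot uzq^n / (1 - (1-u)zq^n)$.
\<close>

section \<open>Pivots in graded posets\<close>

text \<open>The status of a slice depends on both of its neighbours, so deleting one slice could
  change the status of the slices next to it. Stability under deletion is therefore isolated as two
  laws, \<open>np_above\<close> and \<open>np_below\<close>, next to \<open>insertion\<close>; from
  these alone all statements about chains follow by deleting or inserting one non-pivot at a time.

  For slices the non-pivot of a given weight arises by filling an interval greedily from the left.
  The delicate point is the inequality between the last row and the first, which could forbid the
  leftmost box; it never does when the profile has positive sum.

  A further obstacle is that the poset has no top and the sums are infinite. Chains are bounded by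
  one slice above all slices of weight at most \<open>M\<close>; the sums over chains become finite,
  and the identity is compared one coefficient at a time. As the coefficients form a ring without
  division, quotients enter through multiplied-out relations such as
  \<open>(1 + g n) * h n = g n\<close>.\<close>

fun chain_pivots :: "('a \<Rightarrow> 'a \<Rightarrow> 'a \<Rightarrow> bool) \<Rightarrow> 'a \<Rightarrow> 'a list \<Rightarrow> 'a list" where
  "chain_pivots np a (b # d # xs) =
     (if np a b d then chain_pivots np b (d # xs) else b # chain_pivots np b (d # xs))"
| "chain_pivots np a _ = []"

text \<open>\<open>np a b d\<close> reads: \<open>b\<close> is not a pivot between its neighbours \<open>a\<close> and \<open>d\<close>.\<close>

locale pivot_order =
  fixes L :: "'a set"
    and less :: "'a \<Rightarrow> 'a \<Rightarrow> bool" (infix \<open>\<sqsubset>\<close> 50)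
    and w :: "'a \<Rightarrow> nat"
    and np :: "'a \<Rightarrow> 'a \<Rightarrow> 'a \<Rightarrow> bool"
  assumes trans: "a \<sqsubset> b \<Longrightarrow> b \<sqsubset> d \<Longrightarrow> a \<sqsubset> d"
    and rank: "a \<sqsubset> b \<Longrightarrow> w a < w b"
    and np_above: "\<lbrakk>{a, e, b, d} \<subseteq> L; a \<sqsubset> e; e \<sqsubset> b; b \<sqsubset> d; np e b d\<rbrakk> \<Longrightarrow> np a e b \<longleftrightarrow> np a e d"
    and np_below: "\<lbrakk>{a, b, d, x} \<subseteq> L; a \<sqsubset> b; b \<sqsubset> d; d \<sqsubset> x; np a b d\<rbrakk> \<Longrightarrow> np b d x \<longleftrightarrow> np a d x"
    and insertion: "\<lbrakk>a \<in> L; d \<in> L; a \<sqsubset> d; w a < n; n < w d\<rbrakk>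
      \<Longrightarrow> \<exists>!b. b \<in> L \<and> a \<sqsubset> b \<and> b \<sqsubset> d \<and> w b = n \<and> np a b d"
begin

section \<open>Deleting non-pivots from a chain\<close>

abbreviation "piv \<equiv> chain_pivots np"

definition chains :: "'a \<Rightarrow> 'a \<Rightarrow> 'a list set" where
  "chains a t = {S. set S \<subseteq> L \<and> sorted_wrt (\<sqsubset>) (a # S @ [t])}"

lemma set_piv: "set (piv a (S @ [t])) \<subseteq> set S"
proof (induction S arbitrary: a)
  case (Cons b S)
  then show ?case by (cases S) auto
qed simp

text \<open>Only \<open>b\<close> and its two neighbours have \<open>b\<close> in their status.
  \<open>b\<close> itself contributes nothing, the element before it keeps its status by
  \<open>np_above\<close>, and \<open>d\<close> keeps its own by \<open>np_below\<close>; the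
  induction on \<open>A\<close> merely walks to that place.\<close>

lemma piv_remove:
  assumes "set (a # A @ b # d # D) \<subseteq> L" "sorted_wrt (\<sqsubset>) (a # A @ b # d # D)"
    "np (last (a # A)) b d"
  shows "piv a (A @ b # d # D) = piv a (A @ d # D)"
  using assms
proof (induction A arbitrary: a)
  case Nil
  show ?case
  proof (cases D)
    case (Cons x D')
    have "np b d x \<longleftrightarrow> np a d x" using Nil Cons by (intro np_below) auto
    then show ?thesis using Nil Cons by simp
  qed (use Nil in simp)
next
  case (Cons e A)
  have IH: "piv e (A @ b # d # D) = piv e (A @ d # D)" using Cons by auto
  show ?case
  proof (cases A)
    case Nil
    have "np a e b \<longleftrightarrow> np a e d" using Cons.prems Nil by (intro np_above) auto
    then show ?thesis using IH Nil by simp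
  qed (use IH in simp)
qed

lemma chains_sorted_weights:
  assumes "S \<in> chains a t"
  shows "sorted_wrt (\<lambda>x y. w x < w y) (a # S @ [t])"
  using assms unfolding chains_def by (auto intro: sorted_wrt_mono_rel rank)

lemma inj_on_weight_chain:
  assumes "S \<in> chains a t"
  shows "inj_on w (set S)" "distinct S"
proof -
  have "sorted_wrt (<) (map w S)"
    using chains_sorted_weights[OF assms] by (simp add: sorted_wrt_append sorted_wrt_map)
  then have "distinct (map w S)" using strict_sorted_iff by blast
  then show "inj_on w (set S)" "distinct S" by (simp_all add: distinct_map)
qed

lemma chain_remove:
  assumes "A @ x # B \<in> chains a t"
  shows "A @ B \<in> chains a t"
  using assms by (auto simp: chains_def sorted_wrt_append)

lemma piv_remove_nonpivot:
  assumes "a \<in> L" "t \<in> L" "A @ x # B \<in> chains a t" "np (last (a # A)) x (hd (B @ [t]))"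
  shows "piv a ((A @ x # B) @ [t]) = piv a ((A @ B) @ [t])"
proof -
  obtain d D where dD: "B @ [t] = d # D" by (cases "B @ [t]") auto
  have "set (d # D) \<subseteq> L" unfolding dD[symmetric] using assms by (auto simp: chains_def)
  moreover have "sorted_wrt (\<sqsubset>) (a # A @ x # d # D)"
    unfolding dD[symmetric] using assms by (auto simp: chains_def)
  ultimately have "piv a (A @ x # d # D) = piv a (A @ d # D)"
    using assms dD by (intro piv_remove) (auto simp: chains_def)
  then show ?thesis using dD by simp
qed

text \<open>Pivots are recorded as elements, not as positions, so membership reflects the status of
  one occurrence only if no element repeats. The sentinels \<open>a\<close> and \<open>t\<close>
  serve as neighbours at the two ends, whence \<open>last (a # A)\<close> and
  \<open>hd (B @ [t])\<close>.\<close>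

lemma in_piv_middle:
  assumes "distinct (A @ x # B @ [t])"
  shows "x \<in> set (piv a (A @ x # B @ [t])) \<longleftrightarrow> \<not> np (last (a # A)) x (hd (B @ [t]))"
  using assms
proof (induction A arbitrary: a)
  case Nil
  obtain d D where dD: "B @ [t] = d # D" by (cases "B @ [t]") auto
  have "x \<notin> set (piv x (B @ [t]))" using Nil set_piv[of x B t] by auto
  then show ?case using Nil dD by auto
next
  case (Cons e A)
  obtain d D where dD: "A @ x # B @ [t] = d # D" by (cases "A @ x # B @ [t]") auto
  have "x \<in> set (piv e (A @ x # B @ [t])) \<longleftrightarrow> \<not> np (last (e # A)) x (hd (B @ [t]))"
    using Cons by auto
  moreover have "x \<noteq> e" using Cons.prems by auto
  moreover have "piv a ((e # A) @ x # B @ [t]) =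
      (if np a e d then [] else [e]) @ piv e (A @ x # B @ [t])"
    using dD by simp
  ultimately show ?case by (simp split: if_splits)
qed

lemma nonpivot_split:
  assumes "S \<in> chains a t" "x \<in> set S" "x \<notin> set (piv a (S @ [t]))"
  obtains A B where "S = A @ x # B" "np (last (a # A)) x (hd (B @ [t]))"
proof -
  obtain A B where S: "S = A @ x # B" using assms(2) by (auto simp: in_set_conv_decomp)
  have "sorted_wrt (<) (map w (S @ [t]))"
    using chains_sorted_weights[OF assms(1)] unfolding sorted_wrt_map by simp
  then have "distinct (map w (S @ [t]))" using strict_sorted_iff by blast
  then have "distinct (S @ [t])" by (simp only: distinct_map)
  then have "np (last (a # A)) x (hd (B @ [t]))"
    using in_piv_middle[of A x B t a] assms S by auto
  then show thesis using that S by blast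
qed

lemma piv_all:
  assumes "set S \<subseteq> set (piv a (S @ [t]))" "distinct S"
  shows "piv a (S @ [t]) = S"
  using assms
proof (induction S arbitrary: a)
  case (Cons b S)
  obtain d D where dD: "S @ [t] = d # D" by (cases "S @ [t]") auto
  have nb: "b \<notin> set (piv b (S @ [t]))" using Cons.prems set_piv[of b S t] by auto
  have 1: "piv a ((b # S) @ [t]) = (if np a b d then piv b (S @ [t]) else b # piv b (S @ [t]))"
    using dD by simp
  then have "\<not> np a b d" using Cons.prems nb by auto
  moreover have "set S \<subseteq> set (piv b (S @ [t]))" using Cons.prems 1 calculation by auto
  then have "piv b (S @ [t]) = S" using Cons by simp
  ultimately show ?case using 1 by simp
qed simp

text \<open>Deleting a non-pivot leaves the list of pivots unchanged, so one may delete until only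
  pivots are left. The remaining chain equals its own pivot list, which is thereby seen to be a
  chain and a fixed point.\<close>

lemma piv_chain:
  assumes "a \<in> L" "t \<in> L" "S \<in> chains a t"
  shows "piv a (S @ [t]) \<in> chains a t \<and>
         piv a (piv a (S @ [t]) @ [t]) = piv a (S @ [t])"
  using assms(3)
proof (induction "length S" arbitrary: S rule: less_induct)
  case less
  show ?case
  proof (cases "set S \<subseteq> set (piv a (S @ [t]))")
    case True
    then have "piv a (S @ [t]) = S" using inj_on_weight_chain[OF less.prems] by (intro piv_all)
    then show ?thesis using less.prems by simp
  next
    case False
    then obtain x where "x \<in> set S" "x \<notin> set (piv a (S @ [t]))" by blast
    then obtain A B where S: "S = A @ x # B" "np (last (a # A)) x (hd (B @ [t]))"
      using nonpivot_split less.prems by metis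
    then have "piv a (S @ [t]) = piv a ((A @ B) @ [t])"
      using piv_remove_nonpivot assms less.prems by blast
    moreover have "A @ B \<in> chains a t" using chain_remove less.prems S by blast
    ultimately show ?thesis using less.hyps[of "A @ B"] S by simp
  qed
qed

section \<open>Recovering a chain from its pivots and its weights\<close>

lemma chain_weight_bounds:
  assumes "S \<in> chains a t"
  shows "w ` set S \<subseteq> {w a<..<w t}"
  using chains_sorted_weights[OF assms] by (auto simp: sorted_wrt_append)

lemma split_by_weight:
  assumes "A @ B = A' @ B'" "\<forall>x\<in>set A \<union> set A'. w x < n" "\<forall>x\<in>set B \<union> set B'. n < w x"
  shows "A = A' \<and> B = B'"
proof -
  have "filter (\<lambda>x. w x < n) (A @ B) = A" "filter (\<lambda>x. w x < n) (A' @ B') = A'"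
    "filter (\<lambda>x. n < w x) (A @ B) = B" "filter (\<lambda>x. n < w x) (A' @ B') = B'"
    using assms(2,3) by (auto intro!: filter_True filter_False simp: not_less less_imp_le)
  then show ?thesis using assms(1) by metis
qed

lemma gap_less:
  assumes "A @ B \<in> chains a t"
  shows "last (a # A) \<sqsubset> hd (B @ [t])"
  using assms by (cases "A = []"; cases "B = []") (auto simp: chains_def sorted_wrt_append)

lemma gap_in:
  assumes "a \<in> L" "t \<in> L" "A @ B \<in> chains a t"
  shows "last (a # A) \<in> L" "hd (B @ [t]) \<in> L"
  using assms by (cases "A = []"; cases "B = []"; force simp: chains_def)+

text \<open>Delete from both chains a non-pivot of the same weight. The remainders agree by
  induction, and the deleted elements fill the same gap with the same weight, so they agree by the
  uniqueness in \<open>insertion\<close>. The base case is a chain consisting of pivots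
  only.\<close>

lemma piv_weights_inj:
  assumes "a \<in> L" "t \<in> L"
  shows "inj_on (\<lambda>S. (piv a (S @ [t]), w ` set S)) (chains a t)"
proof (rule inj_onI)
  fix S S' assume "S \<in> chains a t" "S' \<in> chains a t"
    "(piv a (S @ [t]), w ` set S) = (piv a (S' @ [t]), w ` set S')"
  then show "S = S'"
  proof (induction "length S" arbitrary: S S' rule: less_induct)
    case less
    note S = less.prems(1) and S' = less.prems(2)
    have same: "piv a (S @ [t]) = piv a (S' @ [t])" "w ` set S = w ` set S'"
      using less.prems by auto
    show ?case
    proof (cases "set S \<subseteq> set (piv a (S @ [t]))")
      case True
      then have eq: "piv a (S @ [t]) = S" using inj_on_weight_chain[OF S] by (intro piv_all)
      have "set S \<subseteq> set S'" using eq same set_piv[of a S' t] by simp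
      then have "set S = set S'"
        using same inj_on_weight_chain(1)[OF S'] by (metis inj_on_image_eq_iff order_refl)
      then have "piv a (S' @ [t]) = S'"
        using eq same inj_on_weight_chain[OF S'] by (intro piv_all) auto
      then show ?thesis using eq same by simp
    next
      case False
      then obtain x where x: "x \<in> set S" "x \<notin> set (piv a (S @ [t]))" by blast
      then obtain y where y: "y \<in> set S'" "w y = w x" using same by (metis image_iff)
      \<comment> \<open>A pivot \<open>y\<close> would belong to the common pivot list, hence to
        \<open>S\<close>, where \<open>x\<close> is the only element of its weight; but
        \<open>x\<close> is no pivot.\<close>
      have "y \<notin> set (piv a (S' @ [t]))"
      proof
        assume y': "y \<in> set (piv a (S' @ [t]))"
        then have "y \<in> set S" using same set_piv[of a S t] by auto
        then show False using x y y' same inj_on_weight_chain(1)[OF S] by (metis inj_onD)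
      qed
      then obtain A' B' where S'eq: "S' = A' @ y # B'" and npy: "np (last (a # A')) y (hd (B' @ [t]))"
        using nonpivot_split S' y by metis
      obtain A B where Seq: "S = A @ x # B" and npx: "np (last (a # A)) x (hd (B @ [t]))"
        using nonpivot_split S x by metis
      have rem: "A @ B \<in> chains a t" "A' @ B' \<in> chains a t"
        using chain_remove S S' Seq S'eq by blast+
      have bnd: "\<forall>v\<in>set A \<union> set A'. w v < w x" "\<forall>v\<in>set B \<union> set B'. w x < w v"
        using chains_sorted_weights[OF S] chains_sorted_weights[OF S'] Seq S'eq y
        by (auto simp: sorted_wrt_append)
      have "\<forall>v\<in>set (A @ B) \<union> set (A' @ B'). w v \<noteq> w x"
        using bnd by (auto simp: nat_neq_iff)
      then have "w ` set (A @ B) = w ` set S - {w x}" "w ` set (A' @ B') = w ` set S' - {w x}"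
        using Seq S'eq y by auto
      then have "w ` set (A @ B) = w ` set (A' @ B')" using same by simp
      moreover have "piv a ((A @ B) @ [t]) = piv a ((A' @ B') @ [t])"
        using piv_remove_nonpivot[OF assms] S S' Seq S'eq npx npy same by metis
      ultimately have "A @ B = A' @ B'"
        using less.hyps[of "A @ B" "A' @ B'"] rem Seq by simp
      then have AB: "A = A'" "B = B'" using split_by_weight bnd by blast+
      have lx: "last (a # A) \<sqsubset> x" "x \<sqsubset> hd (B @ [t])" "x \<in> L"
        using gap_less[of A "x # B"] gap_less[of "A @ [x]" B] S Seq by (auto simp: chains_def)
      have ly: "last (a # A) \<sqsubset> y" "y \<sqsubset> hd (B @ [t])" "y \<in> L"
        using gap_less[of A "y # B"] gap_less[of "A @ [y]" B] S' S'eq AB by (auto simp: chains_def)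
      have "\<exists>!b. b \<in> L \<and> last (a # A) \<sqsubset> b \<and> b \<sqsubset> hd (B @ [t]) \<and> w b = w x
          \<and> np (last (a # A)) b (hd (B @ [t]))"
        using gap_in[OF assms rem(1)] gap_less[OF rem(1)] lx rank by (intro insertion) auto
      then have "x = y" using lx ly npx npy y AB by blast
      then show ?thesis using AB Seq S'eq by simp
    qed
  qed
qed

text \<open>The weight \<open>n\<close> singles out the gap between \<open>A\<close> and
  \<open>B\<close> in which the new non-pivot has to go; \<open>piv_remove_nonpivot\<close> read
  backwards shows that the pivots are unaffected.\<close>

lemma chain_insert:
  assumes "a \<in> L" "t \<in> L" "S \<in> chains a t" "n \<notin> w ` set S" "w a < n" "n < w t"
  obtains S' where "S' \<in> chains a t" "w ` set S' = insert n (w ` set S)"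
    "piv a (S' @ [t]) = piv a (S @ [t])"
proof -
  define A where "A = takeWhile (\<lambda>x. w x < n) S"
  define B where "B = dropWhile (\<lambda>x. w x < n) S"
  have AB: "S = A @ B" by (simp add: A_def B_def)
  have wA: "\<forall>x\<in>set A. w x < n" unfolding A_def by (auto dest: set_takeWhileD)
  have hdB: "n < w (hd (B @ [t]))"
  proof (cases B)
    case (Cons b B')
    then have "\<not> w b < n" unfolding B_def by (metis hd_dropWhile list.discI list.sel(1))
    moreover have "b \<in> set S" using AB Cons by simp
    ultimately show ?thesis using assms(4) Cons by (metis append_Cons image_eqI linorder_neqE_nat list.sel(1))
  qed (use assms in simp)
  have ABc: "A @ B \<in> chains a t" using AB assms by simp
  have "w (last (a # A)) < n" using wA assms by auto
  then obtain b where b: "b \<in> L" "last (a # A) \<sqsubset> b" "b \<sqsubset> hd (B @ [t])" "w b = n"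
      "np (last (a # A)) b (hd (B @ [t]))"
    using insertion[OF gap_in[OF assms(1,2) ABc] gap_less[OF ABc]] hdB by metis
  have lt1: "x \<sqsubset> b" if "x \<in> set (a # A)" for x
  proof -
    have "sorted_wrt (\<sqsubset>) (a # A)" using ABc by (auto simp: chains_def sorted_wrt_append)
    moreover have eq: "a # A = butlast (a # A) @ [last (a # A)]"
      by (rule append_butlast_last_id[symmetric]) simp
    ultimately have *: "sorted_wrt (\<sqsubset>) (butlast (a # A) @ [last (a # A)])" by argo
    have "x \<in> set (butlast (a # A) @ [last (a # A)])" using that eq by argo
    then have "x \<in> set (butlast (a # A)) \<or> x = last (a # A)" by (simp only: set_append) auto
    then show ?thesis using b(2) * trans unfolding sorted_wrt_append by auto
  qed
  have lt2: "b \<sqsubset> x" if "x \<in> set (B @ [t])" for x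
  proof -
    have "sorted_wrt (\<sqsubset>) (B @ [t])" using ABc by (auto simp: chains_def sorted_wrt_append)
    then show ?thesis using b(3) trans that by (cases B) auto
  qed
  have new: "A @ b # B \<in> chains a t"
    using ABc lt1 lt2 b(1) by (auto simp: chains_def sorted_wrt_append)
  show thesis
  proof (rule that[OF new])
    show "w ` set (A @ b # B) = insert n (w ` set S)" using AB b by auto
    show "piv a ((A @ b # B) @ [t]) = piv a (S @ [t])"
      using piv_remove_nonpivot[OF assms(1,2) new b(5)] AB by simp
  qed
qed

lemma chain_with_weights:
  assumes "a \<in> L" "t \<in> L" "P \<in> chains a t" "w ` set P \<subseteq> N" "N \<subseteq> {w a<..<w t}"
  shows "\<exists>S\<in>chains a t. w ` set S = N \<and> piv a (S @ [t]) = piv a (P @ [t])"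
proof -
  have "finite (N - w ` set P)" using assms(5) finite_subset by blast
  then show ?thesis using assms(4,5)
  proof (induction "N - w ` set P" arbitrary: N rule: finite_induct)
    case empty
    then have "w ` set P = N" by blast
    then show ?case using assms(3) by (intro bexI[of _ P]) simp_all
  next
    case (insert n F)
    have "F = (N - {n}) - w ` set P" "w ` set P \<subseteq> N - {n}" "N - {n} \<subseteq> {w a<..<w t}"
      using insert.hyps(2,4) insert.prems by auto
    then have "\<exists>S\<in>chains a t. w ` set S = N - {n} \<and> piv a (S @ [t]) = piv a (P @ [t])"
      by (fact insert.hyps(3)[of "N - {n}"])
    then obtain S where S: "S \<in> chains a t" "w ` set S = N - {n}" "piv a (S @ [t]) = piv a (P @ [t])"
      by blast
    have "n \<in> N" using insert.hyps(4) by auto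
    moreover from this have "w a < n" "n < w t" using insert.prems(2) by auto
    moreover have "n \<notin> w ` set S" unfolding S(2) by simp
    ultimately obtain S' where "S' \<in> chains a t" "w ` set S' = insert n (w ` set S)"
        "piv a (S' @ [t]) = piv a (S @ [t])"
      using chain_insert[OF assms(1,2) S(1)] by metis
    then show ?case using S \<open>n \<in> N\<close> by (metis insert_Diff)
  qed
qed

text \<open>By \<open>piv_chain\<close> these fixed points are exactly the pivot lists of the chains
  from \<open>a\<close> to \<open>t\<close>.\<close>

definition pivot_lists :: "'a \<Rightarrow> 'a \<Rightarrow> 'a list set" where
  "pivot_lists a t = {P\<in>chains a t. piv a (P @ [t]) = P}"

lemma bij_betw_chains_pivots:
  assumes "a \<in> L" "t \<in> L"
  shows "bij_betw (\<lambda>S. (piv a (S @ [t]), w ` set S)) (chains a t)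
     (SIGMA P:pivot_lists a t. {N. w ` set P \<subseteq> N \<and> N \<subseteq> {w a<..<w t}})"
  unfolding bij_betw_def
proof (intro conjI piv_weights_inj assms equalityI subsetI)
  fix p assume "p \<in> (\<lambda>S. (piv a (S @ [t]), w ` set S)) ` chains a t"
  then obtain S where S: "S \<in> chains a t" "p = (piv a (S @ [t]), w ` set S)" by blast
  then show "p \<in> (SIGMA P:pivot_lists a t. {N. w ` set P \<subseteq> N \<and> N \<subseteq> {w a<..<w t}})"
    using piv_chain[OF assms S(1)] set_piv[of a S t] chain_weight_bounds[OF S(1)]
    unfolding pivot_lists_def by auto
next
  fix p assume "p \<in> (SIGMA P:pivot_lists a t. {N. w ` set P \<subseteq> N \<and> N \<subseteq> {w a<..<w t}})"
  then obtain P N where p: "p = (P, N)" "P \<in> chains a t" "piv a (P @ [t]) = P"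
    "w ` set P \<subseteq> N" "N \<subseteq> {w a<..<w t}" unfolding pivot_lists_def by auto
  obtain S where "S \<in> chains a t" "w ` set S = N" "piv a (S @ [t]) = P"
    using chain_with_weights[OF assms p(2,4,5)] p(3) by auto
  then show "p \<in> (\<lambda>S. (piv a (S @ [t]), w ` set S)) ` chains a t"
    unfolding p(1) by (intro rev_image_eqI[of S]) simp_all
qed

text \<open>The relation \<open>gh\<close> makes \<open>h n\<close> the quotient of
  \<open>g n\<close> by \<open>1 + g n\<close>: each weight of a pivot is given back its factor
  \<open>1 + g n\<close>, so that the product over all weights can be pulled out.\<close>

lemma sum_chains_eq_sum_pivots:
  fixes g h :: "nat \<Rightarrow> 'b::comm_ring_1"
  assumes "a \<in> L" "t \<in> L" "finite (chains a t)"
    and gh: "\<And>n. w a < n \<Longrightarrow> (1 + g n) * h n = g n"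
  shows "(\<Sum>S\<in>chains a t. \<Prod>x\<in>set S. g (w x)) =
    (\<Prod>n\<in>{w a<..<w t}. 1 + g n) * (\<Sum>P\<in>pivot_lists a t. \<Prod>x\<in>set P. h (w x))"
proof -
  let ?I = "{w a<..<w t}"
  have fin: "finite (pivot_lists a t)" using assms(3) unfolding pivot_lists_def by simp
  have "(\<Sum>S\<in>chains a t. \<Prod>x\<in>set S. g (w x)) = (\<Sum>S\<in>chains a t. \<Prod>n\<in>w ` set S. g n)"
    using inj_on_weight_chain(1) by (intro sum.cong refl) (simp add: prod.reindex)
  also have "\<dots> = (\<Sum>(P,N)\<in>(SIGMA P:pivot_lists a t. {N. w ` set P \<subseteq> N \<and> N \<subseteq> ?I}). \<Prod>n\<in>N. g n)"
    using sum.reindex_bij_betw[OF bij_betw_chains_pivots[OF assms(1,2)], of "\<lambda>(P,N). \<Prod>n\<in>N. g n"]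
    by simp
  also have "\<dots> = (\<Sum>P\<in>pivot_lists a t. \<Sum>N | w ` set P \<subseteq> N \<and> N \<subseteq> ?I. \<Prod>n\<in>N. g n)"
    by (intro sum.Sigma[symmetric] fin ballI finite_subset[OF _ finite_Pow_iff[THEN iffD2, of ?I]]) auto
  also have "\<dots> = (\<Sum>P\<in>pivot_lists a t. (\<Prod>n\<in>?I. 1 + g n) * (\<Prod>x\<in>set P. h (w x)))"
  proof (intro sum.cong refl)
    fix P assume "P \<in> pivot_lists a t"
    then have P: "P \<in> chains a t" unfolding pivot_lists_def by simp
    let ?W = "w ` set P"
    have WI: "?W \<subseteq> ?I" by (rule chain_weight_bounds[OF P])
    \<comment> \<open>A set between \<open>?W\<close> and \<open>?I\<close> is \<open>?W\<close>
      together with a free choice among the remaining weights; summing over this choice expands the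
      product of \<open>1 + g n\<close>.\<close>
    have "bij_betw (\<lambda>N. ?W \<union> N) (Pow (?I - ?W)) {N. ?W \<subseteq> N \<and> N \<subseteq> ?I}"
      by (rule bij_betw_byWitness[where f' = "\<lambda>N. N - ?W"]) (use WI in auto)
    then have "(\<Sum>N | ?W \<subseteq> N \<and> N \<subseteq> ?I. \<Prod>n\<in>N. g n) = (\<Sum>N\<in>Pow (?I - ?W). \<Prod>n\<in>?W \<union> N. g n)"
      by (rule sum.reindex_bij_betw[symmetric])
    also have "\<dots> = (\<Sum>N\<in>Pow (?I - ?W). (\<Prod>n\<in>?W. g n) * (\<Prod>n\<in>N. g n))"
    proof (intro sum.cong refl prod.union_disjoint)
      fix N assume N: "N \<in> Pow (?I - ?W)"
      then show "finite N" by (meson PowD finite_Diff finite_greaterThanLessThan finite_subset)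
      show "?W \<inter> N = {}" using N by blast
    qed simp
    also have "\<dots> = (\<Prod>n\<in>?W. g n) * (\<Prod>n\<in>?I - ?W. 1 + g n)"
      using prod_add[of "?I - ?W" g "\<lambda>_. 1"]
      by (simp only: sum_distrib_left[symmetric] finite_Diff finite_greaterThanLessThan
          prod.neutral_const mult_1_right add.commute[of 1])
    also have "(\<Prod>n\<in>?W. g n) = (\<Prod>n\<in>?W. 1 + g n) * (\<Prod>n\<in>?W. h n)"
      unfolding prod.distrib[symmetric] using WI gh by (intro prod.cong refl) auto
    also have "\<dots> * (\<Prod>n\<in>?I - ?W. 1 + g n) = (\<Prod>n\<in>?I. 1 + g n) * (\<Prod>n\<in>?W. h n)"
      using prod.subset_diff[OF WI, of "\<lambda>n. 1 + g n"] by (simp add: mult_ac)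
    also have "(\<Prod>n\<in>?W. h n) = (\<Prod>x\<in>set P. h (w x))"
      using inj_on_weight_chain(1)[OF P] by (simp add: prod.reindex)
    finally show "(\<Sum>N | ?W \<subseteq> N \<and> N \<subseteq> ?I. \<Prod>n\<in>N. g n)
      = (\<Prod>n\<in>?I. 1 + g n) * (\<Prod>x\<in>set P. h (w x))" .
  qed
  finally show ?thesis by (simp add: sum_distrib_left)
qed

section \<open>Summation by the top element of a chain\<close>

lemma chains_snoc:
  assumes "a \<sqsubset> t"
  shows "chains a t = insert [] (\<Union>s\<in>{s\<in>L. a \<sqsubset> s \<and> s \<sqsubset> t}. (\<lambda>S. S @ [s]) ` chains a s)"
proof (intro equalityI subsetI)
  fix S assume "S \<in> chains a t"
  then show "S \<in> insert [] (\<Union>s\<in>{s\<in>L. a \<sqsubset> s \<and> s \<sqsubset> t}. (\<lambda>S. S @ [s]) ` chains a s)"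
    by (cases S rule: rev_cases) (auto simp: chains_def sorted_wrt_append)
next
  fix S assume "S \<in> insert [] (\<Union>s\<in>{s\<in>L. a \<sqsubset> s \<and> s \<sqsubset> t}. (\<lambda>S. S @ [s]) ` chains a s)"
  then show "S \<in> chains a t"
    using assms by (auto simp: chains_def sorted_wrt_append intro: trans)
qed

lemma finite_chains:
  assumes "\<And>t. finite {s\<in>L. s \<sqsubset> t}" "a \<sqsubset> t"
  shows "finite (chains a t)"
  using assms(2)
proof (induction "w t" arbitrary: t rule: less_induct)
  case less
  have "finite {s\<in>L. a \<sqsubset> s \<and> s \<sqsubset> t}"
    by (rule finite_subset[OF _ assms(1)[of t]]) auto
  moreover have "finite (chains a s)" if "a \<sqsubset> s" "s \<sqsubset> t" for s
    using less.hyps[OF rank] that by blast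
  ultimately show ?case unfolding chains_snoc[OF less.prems] by blast
qed

text \<open>Unrolling the recursion for \<open>F\<close> from \<open>t\<close> down to
  \<open>a\<close> produces one term for each chain, namely the product of the factors
  \<open>g\<close> met on the way. Grouping chains by their top element makes this an induction on
  \<open>w t\<close>; the value \<open>F a = 1\<close> is the empty chain.\<close>

lemma sum_below_eq_sum_chains:
  fixes g :: "nat \<Rightarrow> 'b::comm_ring_1"
  assumes fin: "\<And>t. finite {s\<in>L. s \<sqsubset> t}"
    and a: "a \<in> L" "\<And>s. s \<in> L \<Longrightarrow> s \<noteq> a \<Longrightarrow> a \<sqsubset> s"
    and F: "F a = 1" "\<And>s. s \<in> L \<Longrightarrow> s \<noteq> a \<Longrightarrow> F s = g (w s) * (\<Sum>s' | s' \<in> L \<and> s' \<sqsubset> s. F s')"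
    and "a \<sqsubset> t"
  shows "(\<Sum>s | s \<in> L \<and> s \<sqsubset> t. F s) = (\<Sum>S\<in>chains a t. \<Prod>x\<in>set S. g (w x))"
  using \<open>a \<sqsubset> t\<close>
proof (induction "w t" arbitrary: t rule: less_induct)
  case less
  let ?D = "{s\<in>L. a \<sqsubset> s \<and> s \<sqsubset> t}"
  let ?G = "\<lambda>S. \<Prod>x\<in>set S. g (w x)"
  have finD: "finite ?D" by (rule finite_subset[OF _ fin[of t]]) auto
  have finC: "finite (chains a s)" if "s \<in> ?D" for s using finite_chains[OF fin] that by blast
  have F': "F s = (\<Sum>S\<in>chains a s. ?G (S @ [s]))" if "s \<in> ?D" for s
  proof -
    have s: "s \<in> L" "a \<sqsubset> s" "s \<sqsubset> t" using that by auto
    have "(\<Sum>s' | s' \<in> L \<and> s' \<sqsubset> s. F s') = sum ?G (chains a s)"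
      by (rule less.hyps[OF rank[OF s(3)] s(2)])
    moreover have "s \<noteq> a" using rank[OF s(2)] by auto
    ultimately have "F s = g (w s) * sum ?G (chains a s)" using F(2)[OF s(1)] by simp
    also have "\<dots> = (\<Sum>S\<in>chains a s. ?G (S @ [s]))"
      unfolding sum_distrib_left
    proof (intro sum.cong refl)
      fix S assume "S \<in> chains a s"
      then have "s \<notin> set S" using chain_weight_bounds by fastforce
      then show "g (w s) * ?G S = ?G (S @ [s])" by simp
    qed
    finally show ?thesis .
  qed
  have "{s. s \<in> L \<and> s \<sqsubset> t} = insert a ?D" using a less.prems by auto
  moreover have "a \<notin> ?D" using rank by auto
  ultimately have "(\<Sum>s | s \<in> L \<and> s \<sqsubset> t. F s) = 1 + (\<Sum>s\<in>?D. F s)" using finD F(1) by simp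
  also have "(\<Sum>s\<in>?D. F s) = (\<Sum>s\<in>?D. \<Sum>S\<in>(\<lambda>S. S @ [s]) ` chains a s. ?G S)"
    using F' by (intro sum.cong refl) (simp add: sum.reindex inj_on_def)
  also have "\<dots> = (\<Sum>S\<in>(\<Union>s\<in>?D. (\<lambda>S. S @ [s]) ` chains a s). ?G S)"
    using finD finC by (intro sum.UNION_disjoint[symmetric]) auto
  also have "1 + \<dots> = sum ?G (chains a t)"
    unfolding chains_snoc[OF less.prems] using finD finC by (subst sum.insert) auto
  finally show ?case .
qed

end

section \<open>The poset of slices\<close>

text \<open>The last column of row \<open>i\<close>. Adding \<open>beta0\<close> absorbs the
  profile, so that the conditions on a slice become comparisons of columns.\<close>

definition row_end :: "nat list \<Rightarrow> nat list list \<Rightarrow> nat \<Rightarrow> nat" where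
  "row_end c \<sigma> i = beta0 c ! i + length (\<sigma> ! i)"

text \<open>Strictness is expressed by weight instead of inequality as in \<open>slice_less\<close>.
  The two agree on slices, but \<open>pivot_order\<close> asks for \<open>trans\<close> and
  \<open>rank\<close> on the whole type, where \<open>slice_less\<close> has cycles among lists with
  equal row lengths and different entries.\<close>

definition slice_below :: "nat list list \<Rightarrow> nat list list \<Rightarrow> bool" where
  "slice_below \<sigma> \<tau> \<longleftrightarrow>
     list_all2 (\<lambda>\<mu> \<nu>. length \<mu> \<le> length \<nu>) \<sigma> \<tau> \<and> weight \<sigma> < weight \<tau>"

text \<open>Row \<open>i\<close> of the diagram added below has last column
  \<open>row_end c \<sigma> i\<close>, row \<open>j\<close> of the diagram added above has first
  column \<open>Suc (row_end c \<sigma> j)\<close>. Comparing row by row avoids \<open>Max\<close>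
  and \<open>Min\<close> and makes the condition vacuous when a diagram is empty, as at the start of
  the greedy construction.\<close>

definition non_pivot :: "nat list \<Rightarrow> nat list list \<Rightarrow> nat list list \<Rightarrow> nat list list \<Rightarrow> bool" where
  "non_pivot c \<alpha> \<sigma> \<tau> \<longleftrightarrow> (\<forall>i<length c. \<forall>j<length c.
     row_end c \<alpha> i < row_end c \<sigma> i \<and> row_end c \<sigma> j < row_end c \<tau> j \<longrightarrow>
     row_end c \<sigma> i \<le> Suc (row_end c \<sigma> j))"

section \<open>Slices described by their row ends\<close>

lemma beta_nth:
  "length \<sigma> = length c \<Longrightarrow> i < length c \<Longrightarrow> beta c \<sigma> ! i = row_end c \<sigma> i"
  by (simp add: beta_def row_end_def beta0_def)

lemma beta0_Suc:
  assumes "Suc i < length c"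
  shows "beta0 c ! i = beta0 c ! Suc i + c ! Suc i"
  using assms by (simp add: beta0_def sum.atLeast_Suc_lessThan)

lemma beta0_last:
  assumes "length c \<ge> 1"
  shows "beta0 c ! (length c - 1) = c ! 0"
  using assms by (simp add: beta0_def)

lemma beta0_hd:
  assumes "length c \<ge> 1"
  shows "beta0 c ! 0 = sum_list c"
  using assms by (simp add: beta0_def sum_list_sum_nth nth_append sum.atLeast_Suc_lessThan Suc_le_eq
      del: upt_Suc)

lemma nth_default_ones:
  assumes "set \<mu> \<subseteq> {1::nat}"
  shows "nth_default 0 \<mu> j = (if j < length \<mu> then 1 else 0)"
proof -
  have "\<mu> ! j = 1" if "j < length \<mu>" using assms nth_mem[OF that] by blast
  then show ?thesis by (simp add: nth_default_def)
qed

lemma integer_partition_ones: "set \<mu> \<subseteq> {1} \<Longrightarrow> integer_partition \<mu>"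
  by (induction \<mu>) (force simp: integer_partition_def)+

lemma ones_le_iff:
  assumes "set \<mu> \<subseteq> {1::nat}" "set \<nu> \<subseteq> {1}"
  shows "(\<forall>j. nth_default 0 \<mu> j \<ge> nth_default 0 \<nu> (j + k)) \<longleftrightarrow> length \<nu> \<le> length \<mu> + k"
proof
  assume "\<forall>j. nth_default 0 \<mu> j \<ge> nth_default 0 \<nu> (j + k)"
  then have "nth_default 0 \<mu> (length \<mu>) \<ge> nth_default 0 \<nu> (length \<mu> + k)" by blast
  then show "length \<nu> \<le> length \<mu> + k"
    using assms by (simp add: nth_default_ones split: if_splits)
qed (use assms in \<open>auto simp: nth_default_ones\<close>)

text \<open>For rows of ones each cylindric inequality compares lengths, shifted by an entry of the
  profile. Between neighbouring rows this shift is the difference of the entries of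
  \<open>beta0\<close>, so it disappears; around the cylinder \<open>beta0\<close> runs from
  \<open>sum_list c\<close> to \<open>c ! 0\<close>, which leaves the allowed spread
  \<open>sum_list c\<close>.\<close>

lemma slice_iff:
  assumes "length c \<ge> 1"
  shows "slice c \<sigma> \<longleftrightarrow> length \<sigma> = length c \<and> (\<forall>\<mu>\<in>set \<sigma>. set \<mu> \<subseteq> {1}) \<and>
    (\<forall>i. Suc i < length c \<longrightarrow> row_end c \<sigma> (Suc i) \<le> row_end c \<sigma> i) \<and>
    row_end c \<sigma> 0 \<le> row_end c \<sigma> (length c - 1) + sum_list c"
proof (cases "length \<sigma> = length c \<and> (\<forall>\<mu>\<in>set \<sigma>. set \<mu> \<subseteq> {1})")
  case True
  then have ones: "set (\<sigma> ! i) \<subseteq> {1}" if "i < length c" for i using that by simp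
  have "(\<forall>j. nth_default 0 (\<sigma> ! i) j \<ge> nth_default 0 (\<sigma> ! Suc i) (j + c ! Suc i)) \<longleftrightarrow>
      row_end c \<sigma> (Suc i) \<le> row_end c \<sigma> i" if "Suc i < length c" for i
    using that ones[of i] ones[of "Suc i"] by (auto simp: ones_le_iff row_end_def beta0_Suc)
  moreover have "(\<forall>j. nth_default 0 (\<sigma> ! (length c - 1)) j \<ge> nth_default 0 (\<sigma> ! 0) (j + c ! 0)) \<longleftrightarrow>
      row_end c \<sigma> 0 \<le> row_end c \<sigma> (length c - 1) + sum_list c"
  proof -
    have "set (\<sigma> ! 0) \<subseteq> {1}" "set (\<sigma> ! (length c - 1)) \<subseteq> {1}"
      by (intro ones; use assms in linarith)+
    then show ?thesis
      unfolding row_end_def beta0_hd[OF assms] beta0_last[OF assms] by (subst ones_le_iff) auto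
  qed
  moreover have "\<forall>\<mu>\<in>set \<sigma>. integer_partition \<mu>" "\<forall>p\<in>parts \<sigma>. p = 1"
    using True integer_partition_ones by (auto simp: parts_def)
  ultimately show ?thesis using True by (auto simp: slice_def cylindric_partition_def)
next
  case False
  then show ?thesis by (auto simp: slice_def cylindric_partition_def parts_def)
qed

lemma slice_rows:
  assumes "slice c \<sigma>"
  shows "length \<sigma> = length c" "i < length c \<Longrightarrow> set (\<sigma> ! i) \<subseteq> {1}"
  using assms by (auto simp: slice_def cylindric_partition_def parts_def)

lemma slice_weight:
  assumes "slice c \<sigma>"
  shows "weight \<sigma> = (\<Sum>i<length c. length (\<sigma> ! i))"
proof -
  have "sum_list \<mu> = length \<mu>" if "set \<mu> \<subseteq> {1}" for \<mu> :: "nat list"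
    using that by (induction \<mu>) auto
  then show ?thesis
    using slice_rows[OF assms] by (simp add: weight_def sum_list_sum_nth atLeast0LessThan)
qed

lemma slice_eqI:
  assumes "slice c \<sigma>" "slice c \<tau>" "\<And>i. i < length c \<Longrightarrow> row_end c \<sigma> i = row_end c \<tau> i"
  shows "\<sigma> = \<tau>"
proof (rule nth_equalityI)
  show "length \<sigma> = length \<tau>" using assms slice_rows by metis
  fix i assume "i < length \<sigma>"
  then have i: "i < length c" using slice_rows[OF assms(1)] by simp
  show "\<sigma> ! i = \<tau> ! i"
  proof (rule nth_equalityI)
    show len: "length (\<sigma> ! i) = length (\<tau> ! i)" using assms(3)[OF i] by (simp add: row_end_def)
    fix j assume "j < length (\<sigma> ! i)"
    then show "\<sigma> ! i ! j = \<tau> ! i ! j"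
      using len slice_rows(2)[OF assms(1) i] slice_rows(2)[OF assms(2) i]
      by (metis nth_mem singletonD subsetD)
  qed
qed

lemma slice_below_iff:
  assumes "slice c \<sigma>" "slice c \<tau>"
  shows "slice_below \<sigma> \<tau> \<longleftrightarrow>
    (\<forall>i<length c. row_end c \<sigma> i \<le> row_end c \<tau> i) \<and> weight \<sigma> < weight \<tau>"
  using slice_rows(1)[OF assms(1)] slice_rows(1)[OF assms(2)]
  by (auto simp: slice_below_def list_all2_conv_all_nth row_end_def)

lemma rows_le_weight_eq:
  assumes "slice c \<sigma>" "slice c \<tau>" "\<And>i. i < length c \<Longrightarrow> row_end c \<sigma> i \<le> row_end c \<tau> i"
    "weight \<tau> \<le> weight \<sigma>"
  shows "\<sigma> = \<tau>"
proof (rule slice_eqI[OF assms(1,2)], rule ccontr)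
  fix i assume i: "i < length c" "row_end c \<sigma> i \<noteq> row_end c \<tau> i"
  have "(\<Sum>i<length c. length (\<sigma> ! i)) < (\<Sum>i<length c. length (\<tau> ! i))"
    using assms(3) i
    by (intro sum_strict_mono_ex1) (auto simp: row_end_def intro!: bexI[of _ i] le_neq_trans)
  then show False using assms by (simp add: slice_weight)
qed

lemma slice_below_strict_row:
  assumes "slice c \<sigma>" "slice c \<tau>" "slice_below \<sigma> \<tau>"
  obtains i where "i < length c" "row_end c \<sigma> i < row_end c \<tau> i"
  using rows_le_weight_eq[OF assms(2,1)] assms
  by (metis less_irrefl linorder_not_less nat_less_le slice_below_iff)

lemma slice_less_iff_below:
  assumes "slice c \<sigma>" "slice c \<tau>"
  shows "slice_less \<sigma> \<tau> \<longleftrightarrow> slice_below \<sigma> \<tau>"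
proof -
  have "list_all2 (\<lambda>\<mu> \<nu>. length \<mu> \<le> length \<nu>) \<sigma> \<tau> \<longleftrightarrow>
      (\<forall>i<length c. row_end c \<sigma> i \<le> row_end c \<tau> i)"
    using slice_rows(1)[OF assms(1)] slice_rows(1)[OF assms(2)]
    by (auto simp: list_all2_conv_all_nth row_end_def)
  then show ?thesis
    using rows_le_weight_eq[OF assms] slice_below_iff[OF assms]
    unfolding slice_less_def by (metis less_irrefl linorder_not_less)
qed

lemma slice_antitone:
  assumes "slice c \<sigma>" "i \<le> j" "j < length c"
  shows "row_end c \<sigma> j \<le> row_end c \<sigma> i"
proof -
  have "length c \<ge> 1" using assms(3) by simp
  note * = assms(1)[unfolded slice_iff[OF this]]
  show ?thesis using assms(2,3)
  proof (induction j rule: dec_induct)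
    case (step k)
    then have "row_end c \<sigma> (Suc k) \<le> row_end c \<sigma> k" using * by simp
    then show ?case using step by simp
  qed simp
qed

lemma slice_spread:
  assumes "slice c \<sigma>" "i < length c" "j < length c"
  shows "row_end c \<sigma> i \<le> row_end c \<sigma> j + sum_list c"
proof -
  have c: "length c \<ge> 1" using assms(3) by simp
  have "row_end c \<sigma> i \<le> row_end c \<sigma> 0" by (rule slice_antitone) (use assms in auto)
  also have "\<dots> \<le> row_end c \<sigma> (length c - 1) + sum_list c"
    using assms(1) slice_iff[OF c] by blast
  also have "row_end c \<sigma> (length c - 1) \<le> row_end c \<sigma> j"
    by (rule slice_antitone) (use assms in auto)
  finally show ?thesis by simp
qed

section \<open>Existence and uniqueness of the non-pivot of a given weight\<close>

lemma add_box:
  assumes "slice c \<sigma>" "i < length c"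
    and up: "\<And>k. k < i \<Longrightarrow> row_end c \<sigma> i < row_end c \<sigma> k"
    and wrap: "row_end c \<sigma> i < row_end c \<sigma> (length c - 1) + sum_list c"
  defines "\<sigma>' \<equiv> \<sigma>[i := 1 # \<sigma> ! i]"
  shows "slice c \<sigma>'" "weight \<sigma>' = Suc (weight \<sigma>)"
    "\<And>k. k < length c \<Longrightarrow> row_end c \<sigma>' k = (if k = i then Suc (row_end c \<sigma> i) else row_end c \<sigma> k)"
proof -
  have c: "length c \<ge> 1" using assms(2) by simp
  note * = assms(1)[unfolded slice_iff[OF c]]
  show re: "row_end c \<sigma>' k = (if k = i then Suc (row_end c \<sigma> i) else row_end c \<sigma> k)"
    if "k < length c" for k
    using that * by (simp add: row_end_def \<sigma>'_def)
  have "set \<mu> \<subseteq> {1}" if "\<mu> \<in> set \<sigma>'" for \<mu>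
  proof -
    have "\<mu> = 1 # \<sigma> ! i \<or> \<mu> \<in> set \<sigma>"
      using that set_update_subset_insert[of \<sigma> i "1 # \<sigma> ! i"] unfolding \<sigma>'_def by blast
    then show ?thesis using * slice_rows(2)[OF assms(1,2)] by auto
  qed
  \<comment> \<open>\<open>up\<close> keeps the row ends weakly decreasing; \<open>wrap\<close>
    keeps the spread within its bound when the first row grows.\<close>
  moreover have "row_end c \<sigma>' (Suc k) \<le> row_end c \<sigma>' k" if "Suc k < length c" for k
    using up[of k] * that by (auto simp: re le_Suc_eq)
  moreover have "row_end c \<sigma>' 0 \<le> row_end c \<sigma>' (length c - 1) + sum_list c"
  proof -
    have "0 < length c" "length c - 1 < length c" using c by linarith+
    note re[OF this(1)] re[OF this(2)]
    then show ?thesis using wrap * by auto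
  qed
  ultimately show sl: "slice c \<sigma>'" using * unfolding slice_iff[OF c] by (simp add: \<sigma>'_def)
  have "weight \<sigma>' = (\<Sum>k<length c. length (\<sigma> ! k) + (if k = i then 1 else 0))"
    unfolding slice_weight[OF sl] using * by (intro sum.cong) (auto simp: \<sigma>'_def nth_list_update)
  then show "weight \<sigma>' = Suc (weight \<sigma>)"
    using assms(2) unfolding slice_weight[OF assms(1)] by (simp add: sum.distrib)
qed

text \<open>Greedy filling: boxes are added to \<alpha> one by one, always in the leftmost column
  available to a row that has not yet reached \<tau>. The columns used so far then never exceed the
  columns still to come, which is \<open>non_pivot\<close>. The bounds are weak so that the
  induction can start at \<alpha>.\<close>

lemma non_pivot_insertion_exists:
  assumes "sum_list c \<ge> 1" "slice c \<alpha>" "slice c \<tau>"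
    and le: "\<And>i. i < length c \<Longrightarrow> row_end c \<alpha> i \<le> row_end c \<tau> i"
    and n: "weight \<alpha> \<le> n" "n \<le> weight \<tau>"
  shows "\<exists>\<sigma>. slice c \<sigma> \<and> (\<forall>i<length c. row_end c \<alpha> i \<le> row_end c \<sigma> i \<and> row_end c \<sigma> i \<le> row_end c \<tau> i)
    \<and> weight \<sigma> = n \<and> non_pivot c \<alpha> \<sigma> \<tau>"
  using n
proof (induction n rule: dec_induct)
  case base
  show ?case using assms(2) le by (intro exI[of _ \<alpha>]) (simp add: non_pivot_def)
next
  case (step n)
  then obtain \<sigma> where \<sigma>: "slice c \<sigma>" "weight \<sigma> = n" "non_pivot c \<alpha> \<sigma> \<tau>"
    and b: "\<And>i. i < length c \<Longrightarrow> row_end c \<alpha> i \<le> row_end c \<sigma> i \<and> row_end c \<sigma> i \<le> row_end c \<tau> i"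
    by auto
  define J where "J = {j. j < length c \<and> row_end c \<sigma> j < row_end c \<tau> j}"
  have "J \<noteq> {}"
    using rows_le_weight_eq[OF assms(3) \<sigma>(1)] \<sigma>(2) step.prems step.hyps
      slice_below_strict_row[OF \<sigma>(1) assms(3)] b unfolding J_def slice_below_iff[OF \<sigma>(1) assms(3)] by auto
  then obtain j0 where j0: "j0 \<in> J" "\<And>j. j \<in> J \<Longrightarrow> row_end c \<sigma> j0 \<le> row_end c \<sigma> j"
    using arg_min_natI[of "\<lambda>j. j \<in> J"] arg_min_nat_le[of "\<lambda>j. j \<in> J"] by blast
  \<comment> \<open>Among the unfinished rows with the smallest row end the topmost is taken. A row
    above it with the same end would also be unfinished, since the row ends of \<tau> decrease, and
    would have been preferred; this gives \<open>up\<close>.\<close>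
  define i where "i = (LEAST j. j \<in> J \<and> row_end c \<sigma> j = row_end c \<sigma> j0)"
  have i: "i \<in> J" "row_end c \<sigma> i = row_end c \<sigma> j0"
    using LeastI[of "\<lambda>j. j \<in> J \<and> row_end c \<sigma> j = row_end c \<sigma> j0"] j0 unfolding i_def by blast+
  have first: "j \<notin> J \<or> row_end c \<sigma> j \<noteq> row_end c \<sigma> i" if "j < i" for j
    using not_less_Least[of j "\<lambda>j. j \<in> J \<and> row_end c \<sigma> j = row_end c \<sigma> j0"] that i
    unfolding i_def[symmetric] by simp
  have min: "row_end c \<sigma> i \<le> row_end c \<sigma> j" if "j \<in> J" for j using i j0(2)[OF that] by simp
  have ic: "i < length c" and it: "row_end c \<sigma> i < row_end c \<tau> i" using i by (auto simp: J_def)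
  have up: "row_end c \<sigma> i < row_end c \<sigma> k" if "k < i" for k
  proof (rule ccontr)
    assume "\<not> row_end c \<sigma> i < row_end c \<sigma> k"
    then have eq: "row_end c \<sigma> k = row_end c \<sigma> i"
      using slice_antitone[OF \<sigma>(1), of k i] that ic by simp
    moreover have "row_end c \<tau> i \<le> row_end c \<tau> k"
      using slice_antitone[OF assms(3), of k i] that ic by simp
    ultimately have "k \<in> J" using it that ic by (simp add: J_def)
    then show False using first[OF that] eq by simp
  qed
  \<comment> \<open>If the last row is unfinished, its row end is at least that of row
    \<open>i\<close>, and \<open>sum_list c\<close> is positive. If it is finished, it ends where
    \<tau> does, and the spread of \<tau> leaves room for one more box in row
    \<open>i\<close>.\<close>
  have wrap: "row_end c \<sigma> i < row_end c \<sigma> (length c - 1) + sum_list c"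
  proof (cases "length c - 1 \<in> J")
    case True
    then show ?thesis using min[OF True] assms(1) by simp
  next
    case False
    then have "row_end c \<tau> (length c - 1) \<le> row_end c \<sigma> (length c - 1)"
      using ic by (auto simp: J_def)
    moreover have "length c - 1 < length c" using ic by linarith
    ultimately show ?thesis using slice_spread[OF assms(3) ic, of "length c - 1"] it by linarith
  qed
  define \<sigma>' where "\<sigma>' = \<sigma>[i := 1 # \<sigma> ! i]"
  have s': "slice c \<sigma>'" "weight \<sigma>' = Suc n"
    and re: "\<And>k. k < length c \<Longrightarrow>
      row_end c \<sigma>' k = (if k = i then Suc (row_end c \<sigma> i) else row_end c \<sigma> k)"
    using add_box[OF \<sigma>(1) ic up wrap] \<sigma>(2) unfolding \<sigma>'_def by auto
  have "non_pivot c \<alpha> \<sigma>' \<tau>"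
    unfolding non_pivot_def
  proof (intro allI impI, elim conjE)
    fix k l assume k: "k < length c" "row_end c \<alpha> k < row_end c \<sigma>' k"
      and l: "l < length c" "row_end c \<sigma>' l < row_end c \<tau> l"
    have lJ: "l \<in> J" "row_end c \<sigma> l \<le> row_end c \<sigma>' l" using l by (auto simp: J_def re split: if_splits)
    show "row_end c \<sigma>' k \<le> Suc (row_end c \<sigma>' l)"
    proof (cases "k = i")
      case True
      then show ?thesis using min[OF lJ(1)] lJ(2) ic by (simp add: re)
    next
      case False
      then have "row_end c \<alpha> k < row_end c \<sigma> k" using k by (simp add: re)
      then have "row_end c \<sigma> k \<le> Suc (row_end c \<sigma> l)"
        using \<sigma>(3) k(1) lJ(1) unfolding non_pivot_def J_def by blast
      then show ?thesis using False k(1) lJ(2) by (simp add: re)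
    qed
  qed
  moreover have "\<forall>k<length c. row_end c \<alpha> k \<le> row_end c \<sigma>' k \<and> row_end c \<sigma>' k \<le> row_end c \<tau> k"
    using b it by (auto simp: re le_SucI)
  ultimately show ?case using s' by blast
qed

text \<open>Having equal weight, each candidate sticks out of the other: \<sigma>' in row
  \<open>i\<close> and \<sigma> in row \<open>j\<close>. For \<sigma>, row \<open>j\<close> has
  gained boxes and row \<open>i\<close> still has to, and conversely for \<sigma>', so
  \<open>non_pivot\<close> applies to both.\<close>

lemma non_pivot_insertion_unique:
  assumes "slice c \<alpha>" "slice c \<tau>" "slice c \<sigma>" "slice c \<sigma>'" "weight \<sigma> = weight \<sigma>'"
    and np: "non_pivot c \<alpha> \<sigma> \<tau>" "non_pivot c \<alpha> \<sigma>' \<tau>"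
    and b: "\<And>i. i < length c \<Longrightarrow> row_end c \<alpha> i \<le> row_end c \<sigma> i \<and> row_end c \<sigma> i \<le> row_end c \<tau> i"
    and b': "\<And>i. i < length c \<Longrightarrow> row_end c \<alpha> i \<le> row_end c \<sigma>' i \<and> row_end c \<sigma>' i \<le> row_end c \<tau> i"
  shows "\<sigma> = \<sigma>'"
proof (rule ccontr)
  assume ne: "\<sigma> \<noteq> \<sigma>'"
  obtain i where i: "i < length c" "row_end c \<sigma> i < row_end c \<sigma>' i"
    using rows_le_weight_eq[OF assms(4,3)] ne assms(5) by (metis leI order_refl)
  obtain j where j: "j < length c" "row_end c \<sigma>' j < row_end c \<sigma> j"
    using rows_le_weight_eq[OF assms(3,4)] ne assms(5) by (metis leI order_refl)
  have "row_end c \<sigma> j \<le> Suc (row_end c \<sigma> i)"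
    using np(1) i j b'[of i] b'[of j] unfolding non_pivot_def by (meson order_le_less_trans order_less_le_trans)
  moreover have "row_end c \<sigma>' i \<le> Suc (row_end c \<sigma>' j)"
    using np(2) i j b[of i] b[of j] unfolding non_pivot_def by (meson order_le_less_trans order_less_le_trans)
  \<comment> \<open>Write \<open>s\<close> and \<open>s'\<close> for the row ends of \<sigma> and
    \<sigma>'. The cycle \<open>s j \<le> s i + 1 \<le> s' i \<le> s' j + 1 \<le> s j\<close> forces
    equality everywhere, so the two slices order the rows \<open>i\<close> and \<open>j\<close>
    strictly and oppositely, although row ends decrease downwards in both.\<close>
  ultimately have "row_end c \<sigma> i < row_end c \<sigma> j" "row_end c \<sigma>' j < row_end c \<sigma>' i"
    using i j by linarith+
  then show False
    using slice_antitone[OF assms(3), of i j] slice_antitone[OF assms(4), of j i] i(1) j(1)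
    by (cases "i \<le> j") auto
qed

section \<open>Stability of pivots under deletion, for slices\<close>

lemma slice_below_rows:
  assumes "slice c \<sigma>" "slice c \<tau>" "slice_below \<sigma> \<tau>" "i < length c"
  shows "row_end c \<sigma> i \<le> row_end c \<tau> i"
  using assms slice_below_iff by blast

text \<open>The columns added from \<open>a\<close> to \<open>e\<close> are at most those from
  \<open>e\<close> to \<open>b\<close>, and these are at most those from \<open>b\<close> to
  \<open>d\<close>. As the middle diagram is nonempty (row \<open>k\<close>), transitivity compares
  the outer two. The converse holds because replacing \<open>d\<close> by the smaller
  \<open>b\<close> only removes conditions.\<close>

lemma non_pivot_above:
  assumes "slice c a" "slice c e" "slice c b" "slice c d"
    "slice_below a e" "slice_below e b" "slice_below b d" "non_pivot c e b d"
  shows "non_pivot c a e b \<longleftrightarrow> non_pivot c a e d"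
proof
  assume np: "non_pivot c a e b"
  obtain k where k: "k < length c" "row_end c e k < row_end c b k"
    using slice_below_strict_row assms by metis
  show "non_pivot c a e d"
    unfolding non_pivot_def
  proof (intro allI impI, elim conjE)
    fix i j assume i: "i < length c" "row_end c a i < row_end c e i"
      and j: "j < length c" "row_end c e j < row_end c d j"
    show "row_end c e i \<le> Suc (row_end c e j)"
    proof (cases "row_end c e j < row_end c b j")
      case True
      then show ?thesis using np i j unfolding non_pivot_def by blast
    next
      case False
      then have "row_end c b j = row_end c e j"
        using slice_below_rows[OF assms(2,3,6) j(1)] by simp
      moreover from this have "row_end c b j < row_end c d j" using j by simp
      then have "row_end c b k \<le> Suc (row_end c b j)"
        using assms(8) k j(1) unfolding non_pivot_def by blast
      moreover have "row_end c e i \<le> Suc (row_end c e k)"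
        using np i k unfolding non_pivot_def by blast
      ultimately show ?thesis using k by linarith
    qed
  qed
next
  assume "non_pivot c a e d"
  then show "non_pivot c a e b"
    using slice_below_rows[OF assms(3,4,7)] unfolding non_pivot_def
    by (meson order_less_le_trans)
qed

text \<open>Mirror image of \<open>non_pivot_above\<close>, with the diagram from \<open>b\<close>
  to \<open>d\<close> as the nonempty link.\<close>

lemma non_pivot_below:
  assumes "slice c a" "slice c b" "slice c d" "slice c x"
    "slice_below a b" "slice_below b d" "slice_below d x" "non_pivot c a b d"
  shows "non_pivot c b d x \<longleftrightarrow> non_pivot c a d x"
proof
  assume np: "non_pivot c b d x"
  obtain k where k: "k < length c" "row_end c b k < row_end c d k"
    using slice_below_strict_row assms by metis
  show "non_pivot c a d x"
    unfolding non_pivot_def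
  proof (intro allI impI, elim conjE)
    fix i j assume i: "i < length c" "row_end c a i < row_end c d i"
      and j: "j < length c" "row_end c d j < row_end c x j"
    show "row_end c d i \<le> Suc (row_end c d j)"
    proof (cases "row_end c b i < row_end c d i")
      case True
      then show ?thesis using np i j unfolding non_pivot_def by blast
    next
      case False
      then have "row_end c d i = row_end c b i"
        using slice_below_rows[OF assms(2,3,6) i(1)] by simp
      moreover from this have "row_end c a i < row_end c b i" using i by simp
      then have "row_end c b i \<le> Suc (row_end c b k)"
        using assms(8) k i(1) unfolding non_pivot_def by blast
      moreover have "row_end c d k \<le> Suc (row_end c d j)"
        using np j k unfolding non_pivot_def by blast
      ultimately show ?thesis using k by linarith
    qed
  qed
next
  assume "non_pivot c a d x"
  then show "non_pivot c b d x"
    using slice_below_rows[OF assms(1,2,5)] unfolding non_pivot_def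
    by (meson order_le_less_trans)
qed

lemma slice_below_trans: "slice_below \<rho> \<sigma> \<Longrightarrow> slice_below \<sigma> \<tau> \<Longrightarrow> slice_below \<rho> \<tau>"
  unfolding slice_below_def list_all2_conv_all_nth by (metis le_trans less_trans)

lemma pivot_order_slices:
  assumes "sum_list c \<ge> 1"
  shows "pivot_order (Collect (slice c)) slice_below weight (non_pivot c)"
proof
  fix a d n assume "a \<in> Collect (slice c)" "d \<in> Collect (slice c)" "slice_below a d"
    and n: "weight a < n" "n < weight d"
  then have ad: "slice c a" "slice c d" "slice_below a d" by auto
  note rows = slice_below_rows[OF ad]
  obtain b where b: "slice c b" "weight b = n" "non_pivot c a b d"
    "\<forall>i<length c. row_end c a i \<le> row_end c b i \<and> row_end c b i \<le> row_end c d i"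
    using non_pivot_insertion_exists[OF assms ad(1,2) rows, of n] n by auto
  show "\<exists>!b. b \<in> Collect (slice c) \<and> slice_below a b \<and> slice_below b d \<and> weight b = n
      \<and> non_pivot c a b d"
  proof (rule ex1I[of _ b])
    show "b \<in> Collect (slice c) \<and> slice_below a b \<and> slice_below b d \<and> weight b = n \<and> non_pivot c a b d"
      using b n ad by (auto simp: slice_below_iff)
  next
    fix b' assume b': "b' \<in> Collect (slice c) \<and> slice_below a b' \<and> slice_below b' d \<and> weight b' = n
      \<and> non_pivot c a b' d"
    then have "slice c b'" by simp
    then show "b' = b"
      by (rule non_pivot_insertion_unique[OF ad(1,2) _ b(1)])
        (use b b' slice_below_rows[OF ad(1)] slice_below_rows[OF _ ad(2)] in auto)
  qed
next
  fix a e b d assume "{a, e, b, d} \<subseteq> Collect (slice c)" "slice_below a e" "slice_below e b"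
    "slice_below b d" "non_pivot c e b d"
  then show "non_pivot c a e b \<longleftrightarrow> non_pivot c a e d" by (intro non_pivot_above) auto
next
  fix a b d x assume "{a, b, d, x} \<subseteq> Collect (slice c)" "slice_below a b" "slice_below b d"
    "slice_below d x" "non_pivot c a b d"
  then show "non_pivot c b d x \<longleftrightarrow> non_pivot c a d x" by (intro non_pivot_below) auto
next
  show "weight a < weight b" if "slice_below a b" for a b
    using that by (simp add: slice_below_def)
qed (rule slice_below_trans)

section \<open>The bottom slice and a bounding top slice\<close>

lemma row_end_empty: "i < length c \<Longrightarrow> row_end c (empty_slice c) i = beta0 c ! i"
  by (simp add: row_end_def empty_slice_def)

lemma slice_empty:
  assumes "length c \<ge> 1"
  shows "slice c (empty_slice c)"
proof -
  have "0 < length c" "length c - 1 < length c" using assms by linarith+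
  from this[THEN row_end_empty]
  have "row_end c (empty_slice c) 0 \<le> row_end c (empty_slice c) (length c - 1) + sum_list c"
    using beta0_hd[OF assms] by simp
  moreover have "length (empty_slice c) = length c" "\<forall>\<mu>\<in>set (empty_slice c). set \<mu> \<subseteq> {1}"
    by (auto simp: empty_slice_def)
  ultimately show ?thesis unfolding slice_iff[OF assms] by (simp add: row_end_empty beta0_Suc)
qed

lemma weight_empty: "weight (empty_slice c) = 0"
  by (simp add: weight_def empty_slice_def sum_list_replicate)

lemma empty_below_iff:
  assumes "length c \<ge> 1" "slice c \<sigma>"
  shows "slice_below (empty_slice c) \<sigma> \<longleftrightarrow> \<sigma> \<noteq> empty_slice c"
proof -
  have le: "row_end c (empty_slice c) i \<le> row_end c \<sigma> i" if "i < length c" for i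
    using that by (simp add: row_end_def empty_slice_def)
  then show ?thesis
    using rows_le_weight_eq[OF slice_empty[OF assms(1)] assms(2) le]
    by (auto simp: slice_below_iff[OF slice_empty[OF assms(1)] assms(2)] weight_empty)
qed

text \<open>
  A slice whose rows all end in the same column. As the top element of a chain it replaces
  $\beta_{s+1}$: the leftmost column of the last skew diagram, hence the pivots, are the same, and
  the insertion lemma then also applies above the last slice.
\<close>

definition full_slice :: "nat list \<Rightarrow> nat \<Rightarrow> nat list list" where
  "full_slice c M = map (\<lambda>i. replicate (sum_list c + Suc M - beta0 c ! i) 1) [0..<length c]"

text \<open>Ensures that the truncated subtraction in \<open>full_slice\<close> is exact.\<close>

lemma beta0_le_sum:
  assumes "i < length c"
  shows "beta0 c ! i \<le> sum_list c"
proof -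
  have c: "length c \<ge> 1" using assms by simp
  have "row_end c (empty_slice c) i \<le> row_end c (empty_slice c) 0"
    using slice_antitone[OF slice_empty[OF c], of 0 i] assms by simp
  moreover have "0 < length c" using c by linarith
  ultimately show ?thesis using assms by (simp add: row_end_empty beta0_hd[OF c])
qed

lemma row_end_full: "i < length c \<Longrightarrow> row_end c (full_slice c M) i = sum_list c + Suc M"
  using beta0_le_sum[of i c] by (simp add: row_end_def full_slice_def)

lemma slice_full:
  assumes "length c \<ge> 1"
  shows "slice c (full_slice c M)"
proof -
  have "0 < length c" "length c - 1 < length c" using assms by linarith+
  from this[THEN row_end_full, of M]
  have "row_end c (full_slice c M) 0 \<le> row_end c (full_slice c M) (length c - 1) + sum_list c"
    by simp
  moreover have "length (full_slice c M) = length c" "\<forall>\<mu>\<in>set (full_slice c M). set \<mu> \<subseteq> {1}"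
    by (auto simp: full_slice_def)
  ultimately show ?thesis unfolding slice_iff[OF assms] by (simp add: row_end_full)
qed

lemma weight_full:
  assumes "length c \<ge> 1"
  shows "M < weight (full_slice c M)"
proof -
  have "0 < length c" using assms by linarith
  then have "Suc M \<le> length (full_slice c M ! 0)"
    using beta0_hd[OF assms] by (simp add: full_slice_def)
  also have "\<dots> \<le> weight (full_slice c M)"
    unfolding slice_weight[OF slice_full[OF assms]] using \<open>0 < length c\<close>
    by (intro member_le_sum) auto
  finally show ?thesis by simp
qed

text \<open>A slice of weight at most \<open>M\<close> has rows of length at most \<open>M\<close>,
  which end no later than column \<open>sum_list c + M\<close>, one before the common end of the
  rows of \<open>full_slice c M\<close>.\<close>

lemma below_full:
  assumes "length c \<ge> 1" "slice c \<sigma>" "weight \<sigma> \<le> M"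
  shows "slice_below \<sigma> (full_slice c M)"
  unfolding slice_below_iff[OF assms(2) slice_full[OF assms(1)]]
proof (intro conjI allI impI)
  fix i assume i: "i < length c"
  have "length (\<sigma> ! i) \<le> weight \<sigma>"
    unfolding slice_weight[OF assms(2)] using i by (intro member_le_sum) auto
  then show "row_end c \<sigma> i \<le> row_end c (full_slice c M) i"
    using beta0_le_sum[OF i] assms(3) unfolding row_end_full[OF i] by (simp add: row_end_def)
qed (use weight_full[OF assms(1), of M] assms(3) in simp)

section \<open>Agreement with the pivots defined by columns\<close>

lemma chain_pivots_conv_nth:
  "chain_pivots np a X =
     map (nth X) (filter (\<lambda>j. \<not> np ((a # X) ! j) (X ! j) (X ! Suc j)) [0..<length X - 1])"
proof (induction np a X rule: chain_pivots.induct)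
  case (1 np a b d xs)
  have "[0..<length (b # d # xs) - 1] = 0 # map Suc [0..<length (d # xs) - 1]"
    by (simp add: map_Suc_upt upt_conv_Cons del: upt_Suc)
  then show ?case using 1 by (auto simp: filter_map o_def)
qed auto

text \<open>Extreme columns occur at row ends: the largest column in row \<open>i\<close> of the
  first diagram is \<open>B ! i\<close>, the smallest in row \<open>j\<close> of the second is
  \<open>Suc (B ! j)\<close>. The premises provide a box in each diagram, so that \<open>Max\<close>
  and \<open>Min\<close> are meaningful.\<close>

lemma Max_skew_gt_Min_skew_iff:
  assumes "i < length B" "A ! i < B ! i" "j < length D" "B ! j < D ! j"
  shows "Max (skew_columns B A) > Min (skew_columns D B) \<longleftrightarrow>
    (\<exists>i<length B. \<exists>j<length D. A ! i < B ! i \<and> B ! j < D ! j \<and> B ! i > Suc (B ! j))"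
proof -
  have fin: "finite (skew_columns B A)" "finite (skew_columns D B)" by (auto simp: skew_columns_def)
  have ne: "skew_columns B A \<noteq> {}" "skew_columns D B \<noteq> {}"
    using assms by (auto simp: skew_columns_def)
  have "Max (skew_columns B A) > Min (skew_columns D B) \<longleftrightarrow>
      (\<exists>x\<in>skew_columns B A. \<exists>y\<in>skew_columns D B. y < x)"
    using fin ne by (auto simp: Max_gr_iff Min_less_iff)
  also have "\<dots> \<longleftrightarrow>
      (\<exists>i<length B. \<exists>j<length D. A ! i < B ! i \<and> B ! j < D ! j \<and> B ! i > Suc (B ! j))"
  proof
    assume "\<exists>x\<in>skew_columns B A. \<exists>y\<in>skew_columns D B. y < x"
    then obtain x y i j where "i < length B" "A ! i < x" "x \<le> B ! i" "j < length D" "B ! j < y"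
        "y \<le> D ! j" "y < x"
      unfolding skew_columns_def by auto
    then show "\<exists>i<length B. \<exists>j<length D. A ! i < B ! i \<and> B ! j < D ! j \<and> B ! i > Suc (B ! j)"
      by (intro exI[of _ i] exI[of _ j] conjI) linarith+
  next
    assume "\<exists>i<length B. \<exists>j<length D. A ! i < B ! i \<and> B ! j < D ! j \<and> B ! i > Suc (B ! j)"
    then obtain i j where "i < length B" "j < length D" "A ! i < B ! i" "B ! j < D ! j" "B ! i > Suc (B ! j)"
      by blast
    then have "B ! i \<in> skew_columns B A" "Suc (B ! j) \<in> skew_columns D B" "B ! i > Suc (B ! j)"
      by (auto simp: skew_columns_def Suc_le_eq)
    then show "\<exists>x\<in>skew_columns B A. \<exists>y\<in>skew_columns D B. y < x" by blast
  qed
  finally show ?thesis .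
qed

lemma length_beta: "length \<sigma> = length c \<Longrightarrow> length (beta c \<sigma>) = length c"
  by (simp add: beta_def beta0_def)

lemma beta_empty: "beta c (empty_slice c) = beta0 c"
  by (rule nth_equalityI) (simp_all add: beta_def beta0_def empty_slice_def)

text \<open>Position \<open>j\<close> of the list holds slice number \<open>Suc j\<close> of the
  chain. Before the last slice the two notions agree by \<open>Max_skew_gt_Min_skew_iff\<close>; for
  the last one its artificial successor has to be replaced by \<open>T\<close>.\<close>

lemma is_pivot_Suc_iff:
  assumes "length c \<ge> 1" and T: "T = full_slice c M"
    and sl: "\<And>\<sigma>. \<sigma> \<in> set S \<Longrightarrow> slice c \<sigma>"
    and ch: "sorted_wrt slice_below (empty_slice c # S @ [T])" and j: "j < length S"
  shows "is_pivot c S (Suc j) \<longleftrightarrow>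
    \<not> non_pivot c ((empty_slice c # S @ [T]) ! j) ((S @ [T]) ! j) ((S @ [T]) ! Suc j)"
proof -
  define a b where "a = (empty_slice c # S @ [T]) ! j" and "b = (S @ [T]) ! j"
  have all: "slice c \<sigma>" if "\<sigma> \<in> set (empty_slice c # S @ [T])" for \<sigma>
    using that sl slice_empty[OF assms(1)] slice_full[OF assms(1)] T by auto
  have a: "slice c a" unfolding a_def by (rule all, rule nth_mem) (use j in simp)
  have b: "slice c b" and bS: "b = S ! j" unfolding b_def using j sl by (simp_all add: nth_append)
  have ab: "slice_below a b"
    using sorted_wrt_nth_less[OF ch, of j "Suc j"] j by (simp add: a_def b_def)
  obtain i where i: "i < length c" "row_end c a i < row_end c b i"
    using slice_below_strict_row[OF a b ab] .
  have cb: "chain_beta c S j = beta c a" "chain_beta c S (Suc j) = beta c b"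
    using j by (auto simp: chain_beta_def a_def bS beta_empty nth_Cons nth_append split: nat.split)
  have nth: "beta c a ! k = row_end c a k" "beta c b ! k = row_end c b k" if "k < length c" for k
    using that a b slice_rows(1) beta_nth by metis+
  have len: "length (beta c b) = length c" using b slice_rows(1) length_beta by blast
  show ?thesis
  proof (cases "Suc j < length S")
    case True
    define d where "d = (S @ [T]) ! Suc j"
    have d: "slice c d" and dS: "d = S ! Suc j" unfolding d_def using True sl by (simp_all add: nth_append)
    have bd: "slice_below b d"
      using sorted_wrt_nth_less[OF ch, of "Suc j" "Suc (Suc j)"] j by (simp add: d_def b_def)
    obtain k where k: "k < length c" "row_end c b k < row_end c d k"
      using slice_below_strict_row[OF b d bd] .
    have cd: "chain_beta c S (Suc j + 1) = beta c d"
      using True by (simp add: chain_beta_def dS)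
    have nthd: "beta c d ! k = row_end c d k" if "k < length c" for k
      using that d slice_rows(1) beta_nth by metis
    have lend: "length (beta c d) = length c" using d slice_rows(1) length_beta by blast
    have "is_pivot c S (Suc j) \<longleftrightarrow> (\<exists>i<length c. \<exists>k<length c. row_end c a i < row_end c b i \<and>
        row_end c b k < row_end c d k \<and> row_end c b i > Suc (row_end c b k))"
      unfolding is_pivot_def cd diff_Suc_1 cb using i k
      by (subst Max_skew_gt_Min_skew_iff[of i _ _ k]) (simp_all add: len lend nth nthd cong: conj_cong)
    then show ?thesis
      unfolding non_pivot_def a_def[symmetric] b_def[symmetric] d_def[symmetric]
      by (auto simp: not_le)
  next
    case False
    then have last: "length S = Suc j" using j by simp
    then have "last S = b" by (metis bS diff_Suc_1 last_conv_nth list.size(3) nat.simps(3))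
    then have d: "(S @ [T]) ! Suc j = T" and cd: "chain_beta c S (Suc j + 1) = map Suc (beta c b)"
      using last by (simp_all add: nth_append chain_beta_def)
    \<comment> \<open>Every row gains exactly one box here, so no condition that row
      \<open>k\<close> grows remains.\<close>
    have "is_pivot c S (Suc j) \<longleftrightarrow> (\<exists>i<length c. \<exists>k<length c. row_end c a i < row_end c b i \<and>
        row_end c b i > Suc (row_end c b k))"
      unfolding is_pivot_def cd diff_Suc_1 cb using i
      by (subst Max_skew_gt_Min_skew_iff[of i _ _ i]) (simp_all add: len nth cong: conj_cong)
    \<comment> \<open>Row \<open>k\<close> ends before row \<open>i\<close>, hence before the common
      end of the rows of \<open>T\<close>, and so it also gains a box on the way to
      \<open>T\<close>.\<close>
    moreover have "row_end c b k < row_end c T k"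
      if "i < length c" "k < length c" "row_end c b i > Suc (row_end c b k)" for i k
    proof -
      have "slice_below b T"
        using sorted_wrt_nth_less[OF ch, of "Suc j" "Suc (length S)"] j by (simp add: b_def nth_append)
      then have "row_end c b i \<le> row_end c T i"
        using slice_below_rows[OF b] slice_full[OF assms(1)] T that by blast
      then show ?thesis using that by (simp add: T row_end_full)
    qed
    ultimately have "is_pivot c S (Suc j) \<longleftrightarrow> (\<exists>i<length c. \<exists>k<length c. row_end c a i < row_end c b i \<and>
        row_end c b k < row_end c T k \<and> row_end c b i > Suc (row_end c b k))" by blast
    then show ?thesis
      unfolding non_pivot_def a_def[symmetric] b_def[symmetric] d by (auto simp: not_le)
  qed
qed

lemma pivots_eq_chain_pivots:
  assumes "length c \<ge> 1" "\<And>\<sigma>. \<sigma> \<in> set S \<Longrightarrow> slice c \<sigma>"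
    "sorted_wrt slice_below (empty_slice c # S @ [full_slice c M])"
  shows "pivots c S = chain_pivots (non_pivot c) (empty_slice c) (S @ [full_slice c M])"
proof -
  let ?X = "S @ [full_slice c M]"
  have "pivots c S = map (\<lambda>j. S ! (j - 1)) (filter (is_pivot c S) (map Suc [0..<length S]))"
    by (simp add: pivots_def map_Suc_upt del: upt_Suc)
  also have "\<dots> = map (nth S) (filter (\<lambda>j. is_pivot c S (Suc j)) [0..<length S])"
    by (simp add: filter_map o_def)
  also have "filter (\<lambda>j. is_pivot c S (Suc j)) [0..<length S] =
      filter (\<lambda>j. \<not> non_pivot c ((empty_slice c # ?X) ! j) (?X ! j) (?X ! Suc j)) [0..<length S]"
    using is_pivot_Suc_iff[OF assms(1) refl assms(2,3)] by (intro filter_cong refl) simp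
  also have "map (nth S) \<dots> = map (nth ?X) \<dots>" by (simp add: nth_append)
  also have "\<dots> = chain_pivots (non_pivot c) (empty_slice c) ?X"
    by (simp add: chain_pivots_conv_nth)
  finally show ?thesis .
qed

section \<open>Removing the lowest level\<close>

text \<open>Deleting the lowest level of a row, and its inverse for a row with \<open>n\<close> entries.\<close>

definition lower_row :: "nat list \<Rightarrow> nat list" where
  "lower_row \<mu> = map (\<lambda>x. x - 1) (filter (\<lambda>x. x > 1) \<mu>)"

definition raise_row :: "nat \<Rightarrow> nat list \<Rightarrow> nat list" where
  "raise_row n \<nu> = map Suc \<nu> @ replicate (n - length \<nu>) 1"

lemma integer_partition_Cons:
  "integer_partition (x # \<mu>) \<longleftrightarrow> x > 0 \<and> (\<forall>y\<in>set \<mu>. y \<le> x) \<and> integer_partition \<mu>"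
  by (auto simp: integer_partition_def)

lemma integer_partition_le_1:
  assumes "integer_partition \<mu>" "\<forall>y\<in>set \<mu>. y \<le> 1"
  shows "\<mu> = replicate (length \<mu>) 1"
proof (rule replicate_eqI)
  show "y = 1" if "y \<in> set \<mu>" for y
    using assms that by (auto simp: integer_partition_def le_Suc_eq)
qed simp

lemma raise_lower_row:
  assumes "integer_partition \<mu>"
  shows "raise_row (length \<mu>) (lower_row \<mu>) = \<mu>"
  using assms
proof (induction \<mu>)
  case (Cons x \<mu>)
  show ?case
  proof (cases "x > 1")
    case True
    then show ?thesis using Cons by (simp add: integer_partition_Cons raise_row_def lower_row_def)
  next
    case False
    then have 1: "x # \<mu> = replicate (length (x # \<mu>)) 1"
      using Cons.prems by (intro integer_partition_le_1) (auto simp: integer_partition_Cons)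
    have "lower_row (x # \<mu>) = []" by (subst 1) (simp add: lower_row_def)
    then have "raise_row (length (x # \<mu>)) (lower_row (x # \<mu>)) = replicate (length (x # \<mu>)) 1"
      by (simp add: raise_row_def)
    then show ?thesis using 1 by argo
  qed
qed (simp add: raise_row_def lower_row_def)

lemma lower_raise_row:
  assumes "integer_partition \<nu>"
  shows "lower_row (raise_row n \<nu>) = \<nu>"
proof -
  have "filter (\<lambda>x. x > 1) (map Suc \<nu>) = map Suc \<nu>"
    using assms by (intro filter_True) (auto simp: integer_partition_def)
  then show ?thesis by (simp add: lower_row_def raise_row_def o_def)
qed

lemma length_lower_row: "length (lower_row \<mu>) \<le> length \<mu>"
  by (simp add: lower_row_def)

lemma length_raise_row: "length \<nu> \<le> n \<Longrightarrow> length (raise_row n \<nu>) = n"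
  by (simp add: raise_row_def)

lemma integer_partition_lower_row: "integer_partition \<mu> \<Longrightarrow> integer_partition (lower_row \<mu>)"
  by (induction \<mu>) (auto simp: integer_partition_Cons lower_row_def integer_partition_def diff_le_mono)

lemma integer_partition_raise_row:
  assumes "integer_partition \<nu>"
  shows "integer_partition (raise_row n \<nu>)"
proof -
  have "sorted_wrt (\<ge>) (replicate m (1::nat))" for m by (induction m) auto
  then show ?thesis
    using assms by (auto simp: integer_partition_def raise_row_def sorted_wrt_append sorted_wrt_map)
qed

text \<open>The default value 0 and truncated subtraction fit together: a deleted entry was 1, a
  missing one counts as 0, and both become 0.\<close>

lemma nth_default_lower_row:
  assumes "integer_partition \<mu>"
  shows "nth_default 0 (lower_row \<mu>) j = nth_default 0 \<mu> j - 1"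
  using assms
proof (induction \<mu> arbitrary: j)
  case (Cons x \<mu>)
  show ?case
  proof (cases "x > 1")
    case True
    have "lower_row (x # \<mu>) = (x - 1) # lower_row \<mu>" using True by (simp add: lower_row_def)
    then show ?thesis using Cons by (cases j) (auto simp: integer_partition_Cons)
  next
    case False
    then have le: "\<forall>y\<in>set (x # \<mu>). y \<le> 1" using Cons.prems by (auto simp: integer_partition_Cons)
    then have "lower_row (x # \<mu>) = []" by (auto simp: lower_row_def filter_empty_conv not_less)
    moreover have "nth_default 0 (x # \<mu>) j \<le> 1"
      using le nth_mem[of j "x # \<mu>"] unfolding nth_default_def by auto
    ultimately show ?thesis by simp
  qed
qed (simp add: lower_row_def)

lemma nth_default_raise_row:
  assumes "length \<nu> \<le> n"
  shows "nth_default 0 (raise_row n \<nu>) j = (if j < n then Suc (nth_default 0 \<nu> j) else 0)"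
  using assms by (auto simp: nth_default_def raise_row_def nth_append)

lemma sum_list_raise_row:
  assumes "length \<nu> \<le> n"
  shows "sum_list (raise_row n \<nu>) = sum_list \<nu> + n"
proof -
  have "sum_list (map Suc \<nu>) = sum_list \<nu> + length \<nu>" by (induction \<nu>) auto
  then show ?thesis using assms by (simp add: raise_row_def sum_list_replicate)
qed

lemma set_raise_row:
  "set (raise_row n \<nu>) = Suc ` set \<nu> \<union> (if length \<nu> < n then {1} else {})"
  by (simp add: raise_row_def)

text \<open>Indices modulo \<open>length c\<close> turn the inequality between the last row and the
  first into one more member of a single family, so later arguments need no separate wrap-around
  case.\<close>

lemma cylindric_partition_cyclic:
  assumes "length c \<ge> 1"
  shows "cylindric_partition c \<Lambda> \<longleftrightarrow> length \<Lambda> = length c \<and> (\<forall>i<length c. integer_partition (\<Lambda> ! i)) \<and>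
    (\<forall>i<length c. \<forall>j. nth_default 0 (\<Lambda> ! (Suc i mod length c)) (j + c ! (Suc i mod length c))
       \<le> nth_default 0 (\<Lambda> ! i) j)"
proof -
  have "(\<forall>i<length c. P i (Suc i mod length c)) \<longleftrightarrow>
      (\<forall>i. Suc i < length c \<longrightarrow> P i (Suc i)) \<and> P (length c - 1) 0" for P
  proof (intro iffI conjI allI impI)
    assume *: "\<forall>i<length c. P i (Suc i mod length c)"
    show "P i (Suc i)" if "Suc i < length c" for i
      using *[rule_format, of i] that by simp
    have "length c - 1 < length c" "Suc (length c - 1) = length c" using assms by linarith+
    then show "P (length c - 1) 0" using *[rule_format, of "length c - 1"] by simp
  next
    fix i assume *: "(\<forall>i. Suc i < length c \<longrightarrow> P i (Suc i)) \<and> P (length c - 1) 0" and i: "i < length c"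
    show "P i (Suc i mod length c)"
    proof (cases "Suc i < length c")
      case False
      then have "Suc i = length c" "i = length c - 1" using i by linarith+
      then show ?thesis using * by simp
    qed (use * in simp)
  qed
  from this[of "\<lambda>i i'. \<forall>j. nth_default 0 (\<Lambda> ! i') (j + c ! i') \<le> nth_default 0 (\<Lambda> ! i) j"]
  show ?thesis unfolding cylindric_partition_def by (auto simp: all_set_conv_all_nth)
qed

text \<open>The lowest horizontal slice of \<Lambda>, the one of level 1.\<close>

definition support :: "nat list list \<Rightarrow> nat list list" where
  "support \<Lambda> = map (\<lambda>\<mu>. replicate (length \<mu>) 1) \<Lambda>"

definition lower :: "nat list list \<Rightarrow> nat list list" where
  "lower \<Lambda> = map lower_row \<Lambda>"

definition raise :: "nat list list \<Rightarrow> nat list list \<Rightarrow> nat list list" where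
  "raise \<sigma> \<Lambda> = map2 (\<lambda>\<mu> \<nu>. raise_row (length \<mu>) \<nu>) \<sigma> \<Lambda>"

lemma nth_default_replicate_1: "nth_default 0 (replicate n 1) j = (if j < n then 1 else 0)"
  by (simp add: nth_default_def)

lemma nth_default_pos_iff:
  assumes "integer_partition \<mu>"
  shows "0 < nth_default 0 \<mu> j \<longleftrightarrow> j < length \<mu>"
  using assms by (auto simp: nth_default_def integer_partition_def)

text \<open>An entry is positive exactly at the positions inside its row, so each inequality between
  entries of \<Lambda> passes to the indicators of positivity.\<close>

lemma slice_support:
  assumes "length c \<ge> 1" "cylindric_partition c \<Lambda>"
  shows "slice c (support \<Lambda>)"
proof -
  note cyl = assms(2)[unfolded cylindric_partition_cyclic[OF assms(1)]]
  have r: "Suc i mod length c < length c" for i using assms(1) by (intro mod_less_divisor) linarith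
  have "integer_partition (replicate n 1)" for n by (induction n) (auto simp: integer_partition_def)
  moreover have "nth_default 0 (support \<Lambda> ! (Suc i mod length c)) (j + c ! (Suc i mod length c))
       \<le> nth_default 0 (support \<Lambda> ! i) j" if "i < length c" for i j
  proof -
    let ?i = "Suc i mod length c"
    have "nth_default 0 (\<Lambda> ! ?i) (j + c ! ?i) \<le> nth_default 0 (\<Lambda> ! i) j"
      using cyl that by blast
    moreover have pos: "0 < nth_default 0 (\<Lambda> ! i') j' \<longleftrightarrow> j' < length (\<Lambda> ! i')"
      if "i' < length c" for i' j' using cyl that nth_default_pos_iff by blast
    have "support \<Lambda> ! i' = replicate (length (\<Lambda> ! i')) 1" if "i' < length c" for i'
      using cyl that by (simp add: support_def)
    note nth = this[OF that] this[OF r, of i]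
    ultimately show ?thesis
      using pos[OF that, of j] pos[OF r[of i], of "j + c ! ?i"]
      unfolding nth nth_default_replicate_1 by auto
  qed
  ultimately have "cylindric_partition c (support \<Lambda>)"
    unfolding cylindric_partition_cyclic[OF assms(1)] using cyl by (simp add: support_def)
  then show ?thesis by (auto simp: slice_def parts_def support_def)
qed

lemma cylindric_lower:
  assumes "length c \<ge> 1" "cylindric_partition c \<Lambda>"
  shows "cylindric_partition c (lower \<Lambda>)"
proof -
  note cyl = assms(2)[unfolded cylindric_partition_cyclic[OF assms(1)]]
  have r: "Suc i mod length c < length c" for i using assms(1) by (intro mod_less_divisor) linarith
  show ?thesis
    unfolding cylindric_partition_cyclic[OF assms(1)] using cyl r
    by (simp add: lower_def nth_default_lower_row integer_partition_lower_row diff_le_mono)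
qed

text \<open>As the rows of \<Lambda> fit into \<sigma>, \<open>raise\<close> adds the two arrays of
  entries, and their inequalities add up.\<close>

lemma cylindric_raise:
  assumes "length c \<ge> 1" "slice c \<sigma>" "cylindric_partition c \<Lambda>"
    "\<And>i. i < length c \<Longrightarrow> length (\<Lambda> ! i) \<le> length (\<sigma> ! i)"
  shows "cylindric_partition c (raise \<sigma> \<Lambda>)"
proof -
  note cyl = assms(3)[unfolded cylindric_partition_cyclic[OF assms(1)]]
  have "cylindric_partition c \<sigma>" using assms(2) by (simp add: slice_def)
  note sl = this[unfolded cylindric_partition_cyclic[OF assms(1)]]
  have r: "Suc i mod length c < length c" for i using assms(1) by (intro mod_less_divisor) linarith
  have nth: "raise \<sigma> \<Lambda> ! i = raise_row (length (\<sigma> ! i)) (\<Lambda> ! i)" if "i < length c" for i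
    using that cyl sl by (simp add: raise_def)
  have pos: "0 < nth_default 0 (\<sigma> ! i) j \<longleftrightarrow> j < length (\<sigma> ! i)" if "i < length c" for i j
    using sl that nth_default_pos_iff by blast
  have "nth_default 0 (raise \<sigma> \<Lambda> ! (Suc i mod length c)) (j + c ! (Suc i mod length c))
       \<le> nth_default 0 (raise \<sigma> \<Lambda> ! i) j" if i: "i < length c" for i j
  proof -
    let ?i = "Suc i mod length c"
    have "nth_default 0 (\<Lambda> ! ?i) (j + c ! ?i) \<le> nth_default 0 (\<Lambda> ! i) j"
      "nth_default 0 (\<sigma> ! ?i) (j + c ! ?i) \<le> nth_default 0 (\<sigma> ! i) j" using cyl sl i by blast+
    then show ?thesis
      using pos[OF i, of j] pos[OF r[of i], of "j + c ! ?i"]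
      unfolding nth[OF i] nth[OF r] nth_default_raise_row[OF assms(4)[OF i]]
        nth_default_raise_row[OF assms(4)[OF r]] by auto
  qed
  moreover have "length (raise \<sigma> \<Lambda>) = length c" using cyl sl by (simp add: raise_def)
  ultimately show ?thesis
    unfolding cylindric_partition_cyclic[OF assms(1)] using cyl
    by (simp add: nth integer_partition_raise_row)
qed

section \<open>Generating functions with prescribed lowest level\<close>

lemma fps_infsum_nth:
  fixes f :: "'a \<Rightarrow> 'b::comm_ring_1 fps"
  assumes "\<And>n. finite {x\<in>A. fps_nth (f x) n \<noteq> 0}"
    and "finite B" "B \<subseteq> A" "\<And>x. x \<in> A - B \<Longrightarrow> fps_nth (f x) k = 0"
  shows "fps_nth (infsum f A) k = (\<Sum>x\<in>B. fps_nth (f x) k)"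
  unfolding infsumI[OF fps_has_sumI[OF assms(1)]] fps_nth_Abs_fps
  by (rule sum.mono_neutral_left) (use assms(2-) in auto)

definition stat_monom :: "nat list list \<Rightarrow> int poly poly" where
  "stat_monom \<Lambda> = [:[:0, 1:]:] ^ max_part \<Lambda> * [:0, 1:] ^ st \<Lambda>"

text \<open>Defined by coefficients, each a finite sum, so that its recursion involves no
  convergence.\<close>

definition support_gf :: "nat list \<Rightarrow> nat list list \<Rightarrow> zu_fps" where
  "support_gf c \<sigma> = Abs_fps (\<lambda>k. \<Sum>\<Lambda> | cylindric_partition c \<Lambda> \<and> support \<Lambda> = \<sigma> \<and> weight \<Lambda> = k.
     stat_monom \<Lambda>)"

lemma finite_cylindric_weight: "finite {\<Lambda>. cylindric_partition c \<Lambda> \<and> weight \<Lambda> \<le> k}"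
  by (rule finite_subset[OF _ finite_tuples_weight_le[of "length c" k]])
    (auto simp: cylindric_partition_def)

lemma finite_slices_below: "finite {\<sigma>. slice c \<sigma> \<and> slice_below \<sigma> \<tau>}"
  by (rule finite_subset[OF _ finite_cylindric_weight[of c "weight \<tau>"]])
    (auto simp: slice_def slice_below_def)

lemma cylindric_length: "cylindric_partition c \<Lambda> \<Longrightarrow> length \<Lambda> = length c"
  by (simp add: cylindric_partition_def)

lemma weight_eq_sum: "length \<Lambda> = n \<Longrightarrow> weight \<Lambda> = (\<Sum>i<n. sum_list (\<Lambda> ! i))"
  by (auto simp: weight_def sum_list_sum_nth[of "map _ _"] atLeast0LessThan)

lemma parts_eq_UN: "length \<Lambda> = n \<Longrightarrow> parts \<Lambda> = (\<Union>i<n. set (\<Lambda> ! i))"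
  by (auto simp: parts_def set_conv_nth[of \<Lambda>])

lemma support_eq_iff:
  assumes "length c \<ge> 1" "cylindric_partition c \<Lambda>" "slice c \<sigma>"
  shows "support \<Lambda> = \<sigma> \<longleftrightarrow> (\<forall>i<length c. length (\<Lambda> ! i) = length (\<sigma> ! i))"
proof
  assume "support \<Lambda> = \<sigma>"
  then show "\<forall>i<length c. length (\<Lambda> ! i) = length (\<sigma> ! i)"
    using cylindric_length[OF assms(2)] by (auto simp: support_def)
next
  assume "\<forall>i<length c. length (\<Lambda> ! i) = length (\<sigma> ! i)"
  then show "support \<Lambda> = \<sigma>"
    using cylindric_length[OF assms(2)] slice_support[OF assms(1,2)] assms(3)
    by (intro slice_eqI) (auto simp: row_end_def support_def)
qed

lemma support_le_iff:
  assumes "length c \<ge> 1" "cylindric_partition c \<Lambda>" "slice c \<sigma>"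
  shows "support \<Lambda> = \<sigma> \<or> slice_below (support \<Lambda>) \<sigma> \<longleftrightarrow>
    (\<forall>i<length c. length (\<Lambda> ! i) \<le> length (\<sigma> ! i))"
proof -
  note sl = slice_support[OF assms(1,2)]
  have row: "row_end c (support \<Lambda>) i \<le> row_end c \<sigma> i \<longleftrightarrow> length (\<Lambda> ! i) \<le> length (\<sigma> ! i)"
    if "i < length c" for i
    using that cylindric_length[OF assms(2)] by (simp add: row_end_def support_def)
  have "weight (support \<Lambda>) < weight \<sigma>"
    if "\<forall>i<length c. length (\<Lambda> ! i) \<le> length (\<sigma> ! i)" "support \<Lambda> \<noteq> \<sigma>"
    using rows_le_weight_eq[OF sl assms(3)] row that by (meson not_less)
  then show ?thesis
    unfolding slice_below_iff[OF sl assms(3)] using row support_eq_iff[OF assms] by auto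
qed

text \<open>One level \<sigma> is put under \<Lambda>, or the lowest level is taken away. The old
  lowest level becomes the second one and may be any slice contained in \<sigma>.\<close>

lemma bij_betw_raise:
  assumes "length c \<ge> 1" "slice c \<sigma>"
  shows "bij_betw (raise \<sigma>)
    {\<Lambda>. cylindric_partition c \<Lambda> \<and> (support \<Lambda> = \<sigma> \<or> slice_below (support \<Lambda>) \<sigma>)}
    {\<Lambda>. cylindric_partition c \<Lambda> \<and> support \<Lambda> = \<sigma>}"
proof (rule bij_betw_byWitness[where f' = lower])
  note cyc = cylindric_partition_cyclic[OF assms(1)]
  have len: "length \<sigma> = length c" using slice_rows[OF assms(2)] by simp
  have nth: "raise \<sigma> \<Lambda> ! i = raise_row (length (\<sigma> ! i)) (\<Lambda> ! i)"
    if "i < length c" "length \<Lambda> = length c" for i \<Lambda>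
    using that len by (simp add: raise_def)
  show "\<forall>\<Lambda>\<in>{\<Lambda>. cylindric_partition c \<Lambda> \<and> (support \<Lambda> = \<sigma> \<or> slice_below (support \<Lambda>) \<sigma>)}.
      lower (raise \<sigma> \<Lambda>) = \<Lambda>"
    using len by (auto simp: cyc lower_raise_row lower_def raise_def intro!: nth_equalityI)
  show "\<forall>\<Lambda>\<in>{\<Lambda>. cylindric_partition c \<Lambda> \<and> support \<Lambda> = \<sigma>}. raise \<sigma> (lower \<Lambda>) = \<Lambda>"
  proof clarify
    fix \<Lambda> assume \<Lambda>: "cylindric_partition c \<Lambda>" "\<sigma> = support \<Lambda>"
    then show "raise (support \<Lambda>) (lower \<Lambda>) = \<Lambda>"
      by (auto simp: cyc raise_lower_row lower_def raise_def support_def intro!: nth_equalityI)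
  qed
  show "raise \<sigma> ` {\<Lambda>. cylindric_partition c \<Lambda> \<and> (support \<Lambda> = \<sigma> \<or> slice_below (support \<Lambda>) \<sigma>)}
      \<subseteq> {\<Lambda>. cylindric_partition c \<Lambda> \<and> support \<Lambda> = \<sigma>}"
  proof (rule image_subsetI)
    fix \<Lambda> assume "\<Lambda> \<in> {\<Lambda>. cylindric_partition c \<Lambda> \<and> (support \<Lambda> = \<sigma> \<or> slice_below (support \<Lambda>) \<sigma>)}"
    then have \<Lambda>: "cylindric_partition c \<Lambda>" and le: "\<forall>i<length c. length (\<Lambda> ! i) \<le> length (\<sigma> ! i)"
      using support_le_iff[OF assms(1) _ assms(2)] by blast+
    have cyl: "cylindric_partition c (raise \<sigma> \<Lambda>)"
      using cylindric_raise[OF assms \<Lambda>] le by blast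
    moreover have "support (raise \<sigma> \<Lambda>) = \<sigma>"
      unfolding support_eq_iff[OF assms(1) cyl assms(2)]
      using le nth cylindric_length[OF \<Lambda>] by (simp add: length_raise_row)
    ultimately show "raise \<sigma> \<Lambda> \<in> {\<Lambda>. cylindric_partition c \<Lambda> \<and> support \<Lambda> = \<sigma>}" by simp
  qed
  show "lower ` {\<Lambda>. cylindric_partition c \<Lambda> \<and> support \<Lambda> = \<sigma>}
    \<subseteq> {\<Lambda>. cylindric_partition c \<Lambda> \<and> (support \<Lambda> = \<sigma> \<or> slice_below (support \<Lambda>) \<sigma>)}"
  proof (rule image_subsetI)
    fix \<Lambda> assume "\<Lambda> \<in> {\<Lambda>. cylindric_partition c \<Lambda> \<and> support \<Lambda> = \<sigma>}"
    then have \<Lambda>: "cylindric_partition c \<Lambda>" "support \<Lambda> = \<sigma>" by simp_all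
    have cyl: "cylindric_partition c (lower \<Lambda>)" by (rule cylindric_lower[OF assms(1) \<Lambda>(1)])
    have "\<forall>i<length c. length (lower \<Lambda> ! i) \<le> length (\<sigma> ! i)"
      using \<Lambda>(2) support_eq_iff[OF assms(1) \<Lambda>(1) assms(2)] cylindric_length[OF \<Lambda>(1)]
      by (auto simp: lower_def intro!: le_trans[OF length_lower_row])
    then show "lower \<Lambda> \<in> {\<Lambda>. cylindric_partition c \<Lambda> \<and> (support \<Lambda> = \<sigma> \<or> slice_below (support \<Lambda>) \<sigma>)}"
      using cyl support_le_iff[OF assms(1) cyl assms(2)] by simp
  qed
qed

text \<open>All old parts grow by one, and a part 1 appears exactly if some row of \<Lambda> is
  shorter than that row of \<sigma>, that is, if \<open>support \<Lambda>\<close> differs from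
  \<sigma>.\<close>

lemma raise_stats:
  assumes "length c \<ge> 1" "slice c \<sigma>" "\<sigma> \<noteq> empty_slice c" "cylindric_partition c \<Lambda>"
    "support \<Lambda> = \<sigma> \<or> slice_below (support \<Lambda>) \<sigma>"
  shows "weight (raise \<sigma> \<Lambda>) = weight \<Lambda> + weight \<sigma>"
    "stat_monom (raise \<sigma> \<Lambda>) =
       [:[:0, 1:]:] * (if support \<Lambda> = \<sigma> then 1 else [:0, 1:]) * stat_monom \<Lambda>"
proof -
  have len: "length \<sigma> = length c" "length \<Lambda> = length c"
    using slice_rows[OF assms(2)] cylindric_length[OF assms(4)] by simp_all
  have le: "length (\<Lambda> ! i) \<le> length (\<sigma> ! i)" if "i < length c" for i
    using support_le_iff[OF assms(1,4,2)] assms(5) that by blast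
  have nth: "raise \<sigma> \<Lambda> ! i = raise_row (length (\<sigma> ! i)) (\<Lambda> ! i)" if "i < length c" for i
    using that len by (simp add: raise_def)
  have lr: "length (raise \<sigma> \<Lambda>) = length c" using len by (simp add: raise_def)
  show "weight (raise \<sigma> \<Lambda>) = weight \<Lambda> + weight \<sigma>"
    unfolding weight_eq_sum[OF lr] weight_eq_sum[OF len(2)] slice_weight[OF assms(2)]
      sum.distrib[symmetric]
    using le nth by (intro sum.cong) (simp_all add: sum_list_raise_row)
  have eq: "support \<Lambda> = \<sigma> \<longleftrightarrow> \<not> (\<exists>i<length c. length (\<Lambda> ! i) < length (\<sigma> ! i))"
  proof -
    have "length (\<Lambda> ! i) = length (\<sigma> ! i) \<longleftrightarrow> \<not> length (\<Lambda> ! i) < length (\<sigma> ! i)" if "i < length c" for i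
      using le[OF that] by auto
    then show ?thesis unfolding support_eq_iff[OF assms(1,4,2)] by blast
  qed
  have "parts (raise \<sigma> \<Lambda>) = (\<Union>i<length c. Suc ` set (\<Lambda> ! i) \<union>
      (if length (\<Lambda> ! i) < length (\<sigma> ! i) then {1} else {}))"
    unfolding parts_eq_UN[OF lr] by (intro SUP_cong refl) (simp add: nth set_raise_row)
  also have "(\<Union>i<n. Suc ` X i \<union> (if P i then {1} else {})) =
      Suc ` (\<Union>i<n. X i) \<union> (if \<not> (\<exists>i<n. P i) then {} else {1})" for n P and X :: "nat \<Rightarrow> nat set"
    by (auto split: if_splits)
  finally have parts: "parts (raise \<sigma> \<Lambda>) = Suc ` parts \<Lambda> \<union> (if support \<Lambda> = \<sigma> then {} else {1})"
    unfolding parts_eq_UN[OF len(2)] eq .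
  have fin: "finite (parts \<Lambda>)" by (simp add: parts_def)
  have pos: "0 \<notin> parts \<Lambda>"
    using assms(4) by (auto simp: cylindric_partition_def integer_partition_def parts_def)
  have "support \<Lambda> = empty_slice c" if "parts \<Lambda> = {}"
    using that len by (auto simp: parts_def support_def empty_slice_def intro!: replicate_eqI)
  \<comment> \<open>An empty \<Lambda> has the empty slice as support, which differs from \<sigma>;
    a part 1 then appears and the maximum rises from its default 0 to 1.\<close>
  then have ne: "parts \<Lambda> \<noteq> {} \<or> support \<Lambda> \<noteq> \<sigma>" using assms(3) by blast
  have "max_part (raise \<sigma> \<Lambda>) = Suc (max_part \<Lambda>)"
  proof (cases "parts \<Lambda> = {}")
    case True
    then show ?thesis using ne by (simp add: max_part_def parts)
  next
    case False
    have M: "Max (Suc ` parts \<Lambda>) = Suc (Max (parts \<Lambda>))"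
      using mono_Max_commute[of Suc "parts \<Lambda>"] fin False by (simp add: mono_Suc)
    have "Max (insert 1 (Suc ` parts \<Lambda>)) = Suc (Max (parts \<Lambda>))"
      using fin False by (subst Max_insert) (simp_all add: M)
    then show ?thesis using False M by (simp add: max_part_def parts)
  qed
  moreover have "st (raise \<sigma> \<Lambda>) = st \<Lambda> + (if support \<Lambda> = \<sigma> then 0 else 1)"
    using fin pos by (auto simp: st_def parts card_image card_insert_if)
  ultimately show "stat_monom (raise \<sigma> \<Lambda>) =
       [:[:0, 1:]:] * (if support \<Lambda> = \<sigma> then 1 else [:0, 1:]) * stat_monom \<Lambda>"
    unfolding stat_monom_def by (simp only: power_Suc power_add) (simp add: mult_ac)
qed

lemma zvar_X_power_mult_nth:
  "fps_nth (zvar * qvar ^ n * f) k = (if k < n then 0 else [:[:0, 1:]:] * fps_nth f (k - n))"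
proof -
  have "zvar * qvar ^ n * f = qvar ^ n * (zvar * f)" by (simp add: mult_ac)
  then show ?thesis by (simp only: fps_X_power_mult_nth) (simp add: zvar_def)
qed

text \<open>Delete the lowest level \<sigma> and sort by the next one: if it is again \<sigma>, the
  number of distinct parts is unchanged; otherwise it is some smaller \<sigma>' and one factor
  \<open>uvar\<close> appears. The empty slice as \<sigma>' accounts for \<sigma> on its
  own.\<close>

lemma support_gf_rec:
  assumes "length c \<ge> 1" "slice c \<sigma>" "\<sigma> \<noteq> empty_slice c"
  shows "support_gf c \<sigma> = zvar * qvar ^ weight \<sigma> *
    (support_gf c \<sigma> + uvar * (\<Sum>\<sigma>' | slice c \<sigma>' \<and> slice_below \<sigma>' \<sigma>. support_gf c \<sigma>'))"
proof (rule fps_ext)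
  fix k
  define A where "A \<sigma>' n = {\<Lambda>. cylindric_partition c \<Lambda> \<and> support \<Lambda> = \<sigma>' \<and> weight \<Lambda> = n}" for \<sigma>' n
  define B where "B = {\<Lambda>. cylindric_partition c \<Lambda> \<and> (support \<Lambda> = \<sigma> \<or> slice_below (support \<Lambda>) \<sigma>)}"
  let ?D = "{\<sigma>'. slice c \<sigma>' \<and> slice_below \<sigma>' \<sigma>}"
  let ?t = "\<lambda>\<Lambda>. [:[:0, 1:]:] * (if support \<Lambda> = \<sigma> then 1 else [:0, 1:]) * stat_monom \<Lambda>"
  have gf: "fps_nth (support_gf c \<sigma>') n = (\<Sum>\<Lambda>\<in>A \<sigma>' n. stat_monom \<Lambda>)" for \<sigma>' n
    by (simp add: support_gf_def A_def)
  have finA: "finite (A \<sigma>' n)" for \<sigma>' n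
    by (rule finite_subset[OF _ finite_cylindric_weight[of c n]]) (auto simp: A_def)
  note bij = bij_betw_raise[OF assms(1,2), folded B_def]
  have "A \<sigma> k = raise \<sigma> ` {\<Lambda>\<in>B. weight \<Lambda> + weight \<sigma> = k}"
  proof -
    have "A \<sigma> k = {\<Lambda>\<in>raise \<sigma> ` B. weight \<Lambda> = k}"
      unfolding bij_betw_imp_surj_on[OF bij] by (auto simp: A_def)
    also have "\<dots> = raise \<sigma> ` {\<Lambda>\<in>B. weight (raise \<sigma> \<Lambda>) = k}" by blast
    also have "{\<Lambda>\<in>B. weight (raise \<sigma> \<Lambda>) = k} = {\<Lambda>\<in>B. weight \<Lambda> + weight \<sigma> = k}"
      using raise_stats(1)[OF assms] by (auto simp: B_def)
    finally show ?thesis .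
  qed
  moreover have "inj_on (raise \<sigma>) {\<Lambda>\<in>B. weight \<Lambda> + weight \<sigma> = k}"
    using bij_betw_imp_inj_on[OF bij] by (rule inj_on_subset) auto
  ultimately have "fps_nth (support_gf c \<sigma>) k =
      (\<Sum>\<Lambda>\<in>{\<Lambda>\<in>B. weight \<Lambda> + weight \<sigma> = k}. stat_monom (raise \<sigma> \<Lambda>))"
    unfolding gf by (simp add: sum.reindex)
  also have "\<dots> = (\<Sum>\<Lambda>\<in>{\<Lambda>\<in>B. weight \<Lambda> + weight \<sigma> = k}. ?t \<Lambda>)"
    using raise_stats(2)[OF assms] by (intro sum.cong refl) (auto simp: B_def)
  also have "\<dots> = fps_nth (zvar * qvar ^ weight \<sigma> *
    (support_gf c \<sigma> + uvar * (\<Sum>\<sigma>'\<in>?D. support_gf c \<sigma>'))) k"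
  proof (cases "k < weight \<sigma>")
    case True
    then have "{\<Lambda>\<in>B. weight \<Lambda> + weight \<sigma> = k} = {}" by auto
    then show ?thesis using True unfolding zvar_X_power_mult_nth by (simp only: sum.empty if_True)
  next
    case False
    define n where "n = k - weight \<sigma>"
    have "{\<Lambda>\<in>B. weight \<Lambda> + weight \<sigma> = k} = A \<sigma> n \<union> (\<Union>\<sigma>'\<in>?D. A \<sigma>' n)"
      using False slice_support[OF assms(1)] by (auto simp: A_def B_def n_def)
    then have "(\<Sum>\<Lambda>\<in>{\<Lambda>\<in>B. weight \<Lambda> + weight \<sigma> = k}. ?t \<Lambda>) =
        (\<Sum>\<Lambda>\<in>A \<sigma> n. ?t \<Lambda>) + (\<Sum>\<Lambda>\<in>(\<Union>\<sigma>'\<in>?D. A \<sigma>' n). ?t \<Lambda>)"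
      by (simp only:) (intro sum.union_disjoint finA finite_UN_I finite_slices_below,
          auto simp: A_def slice_below_def)
    also have "(\<Sum>\<Lambda>\<in>(\<Union>\<sigma>'\<in>?D. A \<sigma>' n). ?t \<Lambda>) = (\<Sum>\<sigma>'\<in>?D. \<Sum>\<Lambda>\<in>A \<sigma>' n. ?t \<Lambda>)"
      by (intro sum.UNION_disjoint finite_slices_below ballI finA) (auto simp: A_def)
    also have "\<dots> = (\<Sum>\<sigma>'\<in>?D. [:[:0, 1:]:] * [:0, 1:] * (\<Sum>\<Lambda>\<in>A \<sigma>' n. stat_monom \<Lambda>))"
      unfolding sum_distrib_left by (intro sum.cong refl) (auto simp: A_def slice_below_def)
    also have "(\<Sum>\<Lambda>\<in>A \<sigma> n. ?t \<Lambda>) = [:[:0, 1:]:] * (\<Sum>\<Lambda>\<in>A \<sigma> n. stat_monom \<Lambda>)"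
      unfolding sum_distrib_left by (intro sum.cong refl) (auto simp: A_def)
    finally show ?thesis
      using False unfolding zvar_X_power_mult_nth n_def[symmetric] if_not_P[OF False]
      by (simp only: fps_add_nth uvar_def fps_mult_left_const_nth fps_sum_nth gf
          sum_distrib_left[symmetric] distrib_left mult.assoc)
  qed
  finally show "fps_nth (support_gf c \<sigma>) k = fps_nth (zvar * qvar ^ weight \<sigma> *
    (support_gf c \<sigma> + uvar * (\<Sum>\<sigma>'\<in>?D. support_gf c \<sigma>'))) k" .
qed

lemma support_gf_empty:
  assumes "length c \<ge> 1"
  shows "support_gf c (empty_slice c) = 1"
proof (rule fps_ext)
  fix k
  let ?E = "empty_slice c"
  have E: "cylindric_partition c ?E" "support ?E = ?E"
    using slice_empty[OF assms] by (auto simp: slice_def empty_slice_def support_def)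
  have "\<Lambda> = ?E" if "support \<Lambda> = ?E" for \<Lambda>
    unfolding empty_slice_def
  proof (rule replicate_eqI)
    show "length \<Lambda> = length c"
      using arg_cong[OF that, of length] by (simp add: support_def empty_slice_def)
    fix \<mu> assume "\<mu> \<in> set \<Lambda>"
    then have "replicate (length \<mu>) 1 \<in> set (support \<Lambda>)" by (auto simp: support_def)
    then show "\<mu> = []" unfolding that by (simp add: empty_slice_def)
  qed
  then have "support \<Lambda> = ?E \<longleftrightarrow> \<Lambda> = ?E" for \<Lambda> using E(2) by metis
  then have "{\<Lambda>. cylindric_partition c \<Lambda> \<and> support \<Lambda> = ?E \<and> weight \<Lambda> = k} =
      (if k = 0 then {?E} else {})"
    using E(1) weight_empty[of c] by auto
  moreover have "stat_monom ?E = 1"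
    by (simp add: stat_monom_def max_part_def st_def parts_def empty_slice_def)
  ultimately show "fps_nth (support_gf c ?E) k = fps_nth 1 k" by (simp add: support_gf_def)
qed

text \<open>A cylindric partition of weight at most \<open>M\<close> has a support of weight at most
  \<open>M\<close>, which lies below \<open>full_slice c M\<close>; so nothing is lost in these
  degrees.\<close>

lemma cylindric_gf_nth:
  assumes "length c \<ge> 1" "k \<le> M"
  shows "fps_nth (\<Sum>\<^sub>\<infinity>\<Lambda>\<in>cylindric_partitions c. qvar ^ weight \<Lambda> * zvar ^ max_part \<Lambda> * uvar ^ st \<Lambda>) k =
    fps_nth (\<Sum>\<sigma> | slice c \<sigma> \<and> slice_below \<sigma> (full_slice c M). support_gf c \<sigma>) k"
    (is "fps_nth (infsum ?f _) k = _")
proof -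
  let ?B = "{\<Lambda>. cylindric_partition c \<Lambda> \<and> weight \<Lambda> = k}"
  let ?D = "{\<sigma>. slice c \<sigma> \<and> slice_below \<sigma> (full_slice c M)}"
  have finB: "finite ?B"
    by (rule finite_subset[OF _ finite_cylindric_weight[of c k]]) auto
  have nth: "fps_nth (?f \<Lambda>) n = (if weight \<Lambda> = n then stat_monom \<Lambda> else 0)" for \<Lambda> n
  proof -
    have "zvar ^ max_part \<Lambda> * uvar ^ st \<Lambda> = fps_const (stat_monom \<Lambda>)"
      by (simp add: stat_monom_def zvar_def uvar_def)
    then have "?f \<Lambda> = qvar ^ weight \<Lambda> * fps_const (stat_monom \<Lambda>)" by (simp only: mult.assoc)
    then show ?thesis by (simp only: fps_X_power_mult_nth) auto
  qed
  have "fps_nth (infsum ?f (cylindric_partitions c)) k = (\<Sum>\<Lambda>\<in>?B. fps_nth (?f \<Lambda>) k)"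
  proof (rule fps_infsum_nth)
    show "finite {\<Lambda>\<in>cylindric_partitions c. fps_nth (?f \<Lambda>) n \<noteq> 0}" for n
      by (rule finite_subset[OF _ finite_cylindric_weight[of c n]])
        (auto simp: nth cylindric_partitions_def split: if_splits)
  qed (use finB in \<open>auto simp: nth cylindric_partitions_def\<close>)
  also have "\<dots> = (\<Sum>\<Lambda>\<in>?B. stat_monom \<Lambda>)" by (intro sum.cong) (auto simp: nth)
  also have "\<dots> = (\<Sum>\<sigma>\<in>?D. \<Sum>\<Lambda> | \<Lambda> \<in> ?B \<and> support \<Lambda> = \<sigma>. stat_monom \<Lambda>)"
  proof (rule sum.group[symmetric, OF finB finite_slices_below], rule image_subsetI)
    fix \<Lambda> assume \<Lambda>: "\<Lambda> \<in> ?B"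
    then have sl: "slice c (support \<Lambda>)" using slice_support assms(1) by blast
    have len: "length \<Lambda> = length c" using \<Lambda> cylindric_length by blast
    have "length \<mu> \<le> sum_list \<mu>" if "integer_partition \<mu>" for \<mu>
      using that by (induction \<mu>) (auto simp: integer_partition_Cons)
    then have "weight (support \<Lambda>) \<le> weight \<Lambda>"
      using \<Lambda> len unfolding slice_weight[OF sl] weight_eq_sum[OF len]
      by (intro sum_mono) (auto simp: support_def cylindric_partition_def)
    then show "support \<Lambda> \<in> ?D" using below_full[OF assms(1) sl] sl \<Lambda> assms(2) by auto
  qed
  also have "\<dots> = fps_nth (\<Sum>\<sigma>\<in>?D. support_gf c \<sigma>) k"
    by (auto simp: fps_sum_nth support_gf_def conj_ac intro!: sum.cong)
  finally show ?thesis .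
qed

section \<open>Power series\<close>

definition fps_cong :: "nat \<Rightarrow> 'a::comm_ring_1 fps \<Rightarrow> 'a fps \<Rightarrow> bool" where
  "fps_cong k f g \<longleftrightarrow> (\<forall>j\<le>k. fps_nth f j = fps_nth g j)"

lemma fps_cong_mult:
  assumes "fps_cong k f f'" "fps_cong k g g'"
  shows "fps_cong k (f * g) (f' * g')"
  using assms by (auto simp: fps_cong_def fps_mult_nth intro!: sum.cong)

text \<open>The factors beyond index \<open>n\<close> are 1 up to degree \<open>k\<close>, so the
  partial products no longer change there.\<close>

lemma qpoch_inf_cong:
  fixes a :: "'a::comm_ring_1 fps"
  assumes "fps_nth a 0 = 0" "k \<le> n"
  shows "fps_cong k (qpoch_inf a) (\<Prod>i\<le>n. 1 - a * fps_X ^ i)"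
  unfolding fps_cong_def
proof (intro allI impI)
  fix j assume "j \<le> k"
  then have jn: "j \<le> n" using assms(2) by simp
  define p where "p n = (\<Prod>i\<le>n. 1 - a * fps_X ^ i)" for n
  have step: "fps_nth (p (Suc m)) j = fps_nth (p m) j" if "j \<le> m" for m
  proof -
    have "p (Suc m) = p m - fps_X ^ Suc m * (a * p m)" by (simp add: p_def algebra_simps)
    then show ?thesis using that by (simp only: fps_sub_nth fps_X_power_mult_nth) simp
  qed
  have stable: "fps_nth (p m) j = fps_nth (p n) j" if "n \<le> m" for m
    using that by (induction m rule: dec_induct) (use jn in \<open>auto simp: step\<close>)
  \<comment> \<open>\<open>has_prod\<close> also admits the value 0 by way of a vanishing factor; as
    no factor vanishes, it means convergence of the partial products themselves.\<close>
  have "1 - a * fps_X ^ i \<noteq> 0" for i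
  proof
    assume "1 - a * fps_X ^ i = 0"
    then have "fps_nth (1 - a * fps_X ^ i) 0 = 0" by simp
    then show False using assms(1) by simp
  qed
  then have "raw_has_prod (\<lambda>j. 1 - a * fps_X ^ j) 0 (qpoch_inf a)"
    using qpoch_inf_convergent(1)[OF assms(1)] by (auto simp: has_prod_def)
  then have "p \<longlonglongrightarrow> qpoch_inf a" by (simp add: raw_has_prod_def p_def[abs_def])
  then have "\<forall>\<^sub>F m in sequentially. fps_nth (p m) j = fps_nth (qpoch_inf a) j"
    unfolding tendsto_fps_iff by blast
  then have "\<forall>\<^sub>F m in sequentially. fps_nth (p m) j = fps_nth (qpoch_inf a) j \<and> n \<le> m"
    using eventually_ge_at_top[of n] by (rule eventually_conj)
  then have "\<exists>m. fps_nth (p m) j = fps_nth (qpoch_inf a) j \<and> n \<le> m"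
    by (rule eventually_happens'[OF sequentially_bot])
  then have "fps_nth (qpoch_inf a) j = fps_nth (p n) j" by (metis stable)
  then show "fps_nth (qpoch_inf a) j = fps_nth (\<Prod>i\<le>n. 1 - a * fps_X ^ i) j"
    by (simp only: p_def)
qed

text \<open>The expansion is the sum of \<open>u z^k q^(n k)\<close> over \<open>k \<ge> 1\<close>:
  a slice of weight \<open>n\<close> occurs at \<open>k\<close> levels but counts once as a distinct
  part.\<close>

definition chain_weight_gf :: "nat \<Rightarrow> zu_fps" where
  "chain_weight_gf n = uvar * zvar * qvar ^ n * fps_recip (1 - zvar * qvar ^ n)"

definition pivot_weight_gf :: "nat \<Rightarrow> zu_fps" where
  "pivot_weight_gf n = uvar * zvar * qvar ^ n * fps_recip (1 - (1 - uvar) * zvar * qvar ^ n)"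

lemma recip_gf:
  assumes "n > 0"
  shows "(1 - zvar * qvar ^ n) * fps_recip (1 - zvar * qvar ^ n) = 1"
    "(1 - (1 - uvar) * zvar * qvar ^ n) * fps_recip (1 - (1 - uvar) * zvar * qvar ^ n) = 1"
  by (rule fps_mult_recip; use assms in \<open>simp add: fps_mult_nth_0 zero_power\<close>)+

lemma one_plus_chain_weight_gf:
  assumes "n > 0"
  shows "(1 - zvar * qvar ^ n) * (1 + chain_weight_gf n) = 1 - (1 - uvar) * zvar * qvar ^ n"
proof -
  have "(1 - zvar * qvar ^ n) * (1 + chain_weight_gf n) = (1 - zvar * qvar ^ n) +
      uvar * zvar * qvar ^ n * ((1 - zvar * qvar ^ n) * fps_recip (1 - zvar * qvar ^ n))"
    by (simp add: chain_weight_gf_def algebra_simps)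
  then show ?thesis unfolding recip_gf(1)[OF assms] by (simp add: algebra_simps)
qed

lemma chain_weight_gf_eq:
  assumes "n > 0"
  shows "(1 + chain_weight_gf n) * pivot_weight_gf n = chain_weight_gf n"
proof -
  let ?x = "zvar * qvar ^ n"
  have "(1 + chain_weight_gf n) * pivot_weight_gf n =
      ((1 - ?x) * fps_recip (1 - ?x)) * ((1 + chain_weight_gf n) * pivot_weight_gf n)"
    by (simp only: recip_gf(1)[OF assms] mult_1_left)
  also have "\<dots> = fps_recip (1 - ?x) * ((1 - ?x) * (1 + chain_weight_gf n)) * pivot_weight_gf n"
    by (simp only: mult_ac)
  also have "\<dots> = uvar * ?x * fps_recip (1 - ?x) *
     ((1 - (1 - uvar) * zvar * qvar ^ n) * fps_recip (1 - (1 - uvar) * zvar * qvar ^ n))"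
    unfolding one_plus_chain_weight_gf[OF assms] by (simp only: pivot_weight_gf_def mult_ac)
  finally show ?thesis unfolding recip_gf(2)[OF assms] by (simp add: chain_weight_gf_def mult_ac)
qed

text \<open>The recursion \<open>support_gf_rec\<close> is linear in
  \<open>support_gf c \<sigma>\<close>. As the weight of \<sigma> is positive,
  \<open>1 - zvar * qvar ^ weight \<sigma>\<close> is invertible, and solving gives the form
  required by \<open>sum_below_eq_sum_chains\<close>.\<close>

lemma support_gf_eq:
  assumes "length c \<ge> 1" "slice c \<sigma>" "\<sigma> \<noteq> empty_slice c"
  shows "support_gf c \<sigma> = chain_weight_gf (weight \<sigma>) *
    (\<Sum>\<sigma>' | slice c \<sigma>' \<and> slice_below \<sigma>' \<sigma>. support_gf c \<sigma>')"
    (is "?F = _ * ?H")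
proof -
  let ?x = "zvar * qvar ^ weight \<sigma>"
  have pos: "weight \<sigma> > 0"
    using empty_below_iff[OF assms(1,2)] assms(3) by (simp add: slice_below_def weight_empty)
  have "?F = ?x * (?F + uvar * ?H)" by (rule support_gf_rec[OF assms])
  then have *: "(1 - ?x) * ?F = uvar * ?x * ?H" by (simp add: algebra_simps)
  have "?F = ((1 - ?x) * fps_recip (1 - ?x)) * ?F"
    by (simp only: recip_gf(1)[OF pos] mult_1_left)
  also have "\<dots> = fps_recip (1 - ?x) * ((1 - ?x) * ?F)" by (simp only: mult_ac)
  also have "\<dots> = chain_weight_gf (weight \<sigma>) * ?H"
    unfolding * by (simp only: chain_weight_gf_def mult_ac)
  finally show ?thesis .
qed

section \<open>Truncation to chains below a full slice\<close>

lemma strict_slice_chain_iff: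
  assumes "length c \<ge> 1"
  shows "strict_slice_chain c S \<longleftrightarrow>
    (\<forall>\<sigma>\<in>set S. slice c \<sigma>) \<and> sorted_wrt slice_below (empty_slice c # S)"
proof (cases "\<forall>\<sigma>\<in>set S. slice c \<sigma>")
  case True
  have "sorted_wrt slice_less S \<longleftrightarrow> sorted_wrt slice_below S"
    using True slice_less_iff_below
    by (intro iffI; elim sorted_wrt_mono_rel[rotated]) blast+
  then show ?thesis using True empty_below_iff[OF assms] by (auto simp: strict_slice_chain_def)
qed (auto simp: strict_slice_chain_def)

lemma empty_below_full:
  assumes "length c \<ge> 1"
  shows "slice_below (empty_slice c) (full_slice c M)"
  using below_full[OF assms slice_empty[OF assms]] by (simp add: weight_empty)

context
  fixes c :: "nat list"
  assumes c: "length c \<ge> 1" "sum_list c \<ge> 1"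
begin

interpretation pivot_order "Collect (slice c)" slice_below weight "non_pivot c"
  by (rule pivot_order_slices[OF c(2)])

lemma chains_full_iff:
  "S \<in> chains (empty_slice c) (full_slice c M) \<longleftrightarrow>
     strict_slice_chain c S \<and> (\<forall>\<sigma>\<in>set S. slice_below \<sigma> (full_slice c M))"
  unfolding chains_def strict_slice_chain_iff[OF c(1)]
  using empty_below_full[OF c(1), of M] by (auto simp: sorted_wrt_append)

lemma pivots_eq_piv:
  assumes "S \<in> chains (empty_slice c) (full_slice c M)"
  shows "pivots c S = piv (empty_slice c) (S @ [full_slice c M])"
  using assms by (intro pivots_eq_chain_pivots[OF c(1)]) (auto simp: chains_def)

text \<open>Being a fixed point amounts to \<open>pivots c P = P\<close>, which does not mention the
  top slice. A chain with pivots \<open>P\<close> may exceed \<open>full_slice c M\<close>; it is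
  placed under a larger top, whose index is the sum of all weights in the chain, and the fixed point
  \<open>P\<close> is then carried back.\<close>

lemma pivot_lists_full_iff:
  "P \<in> pivot_lists (empty_slice c) (full_slice c M) \<longleftrightarrow>
     P \<in> pivot_chains c (length P) \<and> (\<forall>\<sigma>\<in>set P. slice_below \<sigma> (full_slice c M))"
proof
  assume "P \<in> pivot_lists (empty_slice c) (full_slice c M)"
  then have "P \<in> chains (empty_slice c) (full_slice c M)"
    "piv (empty_slice c) (P @ [full_slice c M]) = P" by (auto simp: pivot_lists_def)
  then show "P \<in> pivot_chains c (length P) \<and> (\<forall>\<sigma>\<in>set P. slice_below \<sigma> (full_slice c M))"
    using pivots_eq_piv[of P M] chains_full_iff[of P M] by (auto simp: pivot_chains_def)
next
  assume P: "P \<in> pivot_chains c (length P) \<and> (\<forall>\<sigma>\<in>set P. slice_below \<sigma> (full_slice c M))"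
  then obtain S where S: "strict_slice_chain c S" "pivots c S = P" by (auto simp: pivot_chains_def)
  define N where "N = (\<Sum>\<sigma>\<in>set S. weight \<sigma>)"
  have "slice_below \<sigma> (full_slice c N)" if "\<sigma> \<in> set S" for \<sigma>
    using that S(1) by (intro below_full[OF c(1)]) (auto simp: N_def strict_slice_chain_def intro: member_le_sum)
  then have SN: "S \<in> chains (empty_slice c) (full_slice c N)" using S(1) chains_full_iff by blast
  have L: "empty_slice c \<in> Collect (slice c)" "full_slice c N \<in> Collect (slice c)"
    using slice_empty[OF c(1)] slice_full[OF c(1)] by auto
  have PN: "P \<in> chains (empty_slice c) (full_slice c N)" "piv (empty_slice c) (P @ [full_slice c N]) = P"
    using piv_chain[OF L SN] pivots_eq_piv[OF SN] S(2) by auto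
  then have PM: "P \<in> chains (empty_slice c) (full_slice c M)" using P chains_full_iff by blast
  then have "piv (empty_slice c) (P @ [full_slice c M]) = P"
    using pivots_eq_piv[OF PN(1)] pivots_eq_piv[OF PM] PN(2) by simp
  then show "P \<in> pivot_lists (empty_slice c) (full_slice c M)" using PM by (simp add: pivot_lists_def)
qed

lemma finite_chains_full: "finite (chains (empty_slice c) (full_slice c M))"
  using finite_slices_below by (intro finite_chains empty_below_full c(1)) simp

lemma cylindric_gf_cong:
  assumes "k \<le> M"
  shows "fps_cong k (\<Sum>\<^sub>\<infinity>\<Lambda>\<in>cylindric_partitions c. qvar ^ weight \<Lambda> * zvar ^ max_part \<Lambda> * uvar ^ st \<Lambda>)
    ((\<Prod>n\<in>{0<..<weight (full_slice c M)}. 1 + chain_weight_gf n) *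
     (\<Sum>P\<in>pivot_lists (empty_slice c) (full_slice c M). \<Prod>\<sigma>\<in>set P. pivot_weight_gf (weight \<sigma>)))"
proof -
  let ?E = "empty_slice c" and ?T = "full_slice c M"
  have L: "?E \<in> Collect (slice c)" "?T \<in> Collect (slice c)"
    using slice_empty[OF c(1)] slice_full[OF c(1)] by auto
  have "(\<Sum>\<sigma> | \<sigma> \<in> Collect (slice c) \<and> slice_below \<sigma> ?T. support_gf c \<sigma>) =
      (\<Sum>S\<in>chains ?E ?T. \<Prod>\<sigma>\<in>set S. chain_weight_gf (weight \<sigma>))"
  proof (rule sum_below_eq_sum_chains)
    show "finite {s \<in> Collect (slice c). slice_below s t}" for t
      using finite_slices_below by simp
    show "slice_below ?E s" if "s \<in> Collect (slice c)" "s \<noteq> ?E" for s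
      using that empty_below_iff[OF c(1)] by simp
    show "support_gf c s = chain_weight_gf (weight s) *
        sum (support_gf c) {s'. s' \<in> Collect (slice c) \<and> slice_below s' s}"
      if "s \<in> Collect (slice c)" "s \<noteq> ?E" for s
      using that support_gf_eq[OF c(1)] by simp
  qed (use L empty_below_full[OF c(1)] support_gf_empty[OF c(1)] in auto)
  also have "\<dots> = (\<Prod>n\<in>{weight ?E<..<weight ?T}. 1 + chain_weight_gf n) *
      (\<Sum>P\<in>pivot_lists ?E ?T. \<Prod>\<sigma>\<in>set P. pivot_weight_gf (weight \<sigma>))"
    by (rule sum_chains_eq_sum_pivots[OF L finite_chains_full]) (simp add: weight_empty chain_weight_gf_eq)
  finally have eq: "(\<Sum>\<sigma> | \<sigma> \<in> Collect (slice c) \<and> slice_below \<sigma> ?T. support_gf c \<sigma>) = \<dots>" .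
  show ?thesis
    unfolding fps_cong_def
  proof (intro allI impI)
    fix j assume "j \<le> k"
    then have "j \<le> M" using assms by simp
    from cylindric_gf_nth[OF c(1) this] eq
    show "fps_nth (\<Sum>\<^sub>\<infinity>\<Lambda>\<in>cylindric_partitions c. qvar ^ weight \<Lambda> * zvar ^ max_part \<Lambda> * uvar ^ st \<Lambda>) j =
        fps_nth ((\<Prod>n\<in>{0<..<weight ?T}. 1 + chain_weight_gf n) *
          (\<Sum>P\<in>pivot_lists ?E ?T. \<Prod>\<sigma>\<in>set P. pivot_weight_gf (weight \<sigma>))) j"
      by (simp only: weight_empty mem_Collect_eq)
  qed
qed

lemma pivot_term_eq_prod:
  assumes "P \<in> pivot_lists (empty_slice c) (full_slice c M)" "length P = m"
  shows "pivot_term m P = (\<Prod>\<sigma>\<in>set P. pivot_weight_gf (weight \<sigma>))"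
proof -
  have "distinct P" using assms inj_on_weight_chain(2) unfolding pivot_lists_def by blast
  then have "bij_betw ((!) P) {..<m} (set P)" using assms(2) by (intro bij_betw_nth) auto
  then show ?thesis by (simp add: prod.reindex_bij_betw[symmetric] pivot_weight_gf_def)
qed

text \<open>A chain of pivots not lying below the top slice contains a slice of weight greater than
  \<open>M\<close>; its term is divisible by that power of \<open>qvar\<close> and invisible in
  degree \<open>j\<close>.\<close>

lemma pivot_term_nth_infsum:
  assumes "j \<le> M"
  shows "fps_nth (\<Sum>\<^sub>\<infinity>P\<in>pivot_chains c m. pivot_term m P) j =
    (\<Sum>P | P \<in> pivot_lists (empty_slice c) (full_slice c M) \<and> length P = m.
       fps_nth (\<Prod>\<sigma>\<in>set P. pivot_weight_gf (weight \<sigma>)) j)"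
proof -
  let ?B = "{P. P \<in> pivot_lists (empty_slice c) (full_slice c M) \<and> length P = m}"
  have "fps_nth (\<Sum>\<^sub>\<infinity>P\<in>pivot_chains c m. pivot_term m P) j = (\<Sum>P\<in>?B. fps_nth (pivot_term m P) j)"
  proof (rule fps_infsum_nth[OF pivot_term_finite])
    show "finite ?B" using finite_chains_full[of M] by (simp add: pivot_lists_def)
    show "?B \<subseteq> pivot_chains c m" using pivot_lists_full_iff by auto
    fix P assume "P \<in> pivot_chains c m - ?B"
    then have P: "P \<in> pivot_chains c m" "P \<notin> ?B" by auto
    then have len: "length P = m" by (simp add: pivot_chains_def)
    then obtain \<sigma> where \<sigma>: "\<sigma> \<in> set P" "\<not> slice_below \<sigma> (full_slice c M)"
      using P pivot_lists_full_iff[of P M] by auto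
    then have "M < weight \<sigma>"
      using below_full[OF c(1) pivot_chain_slice(1)[OF P(1)]] by (meson not_le)
    moreover obtain i where i: "i < m" "\<sigma> = P ! i" using \<sigma>(1) len by (auto simp: in_set_conv_nth)
    have "weight (P ! i) \<le> (\<Sum>j<m. weight (P ! j))" using i by (intro member_le_sum) auto
    ultimately show "fps_nth (pivot_term m P) j = 0"
      using assms i by (intro pivot_term_nth_eq_0) simp
  qed
  also have "\<dots> = (\<Sum>P\<in>?B. fps_nth (\<Prod>\<sigma>\<in>set P. pivot_weight_gf (weight \<sigma>)) j)"
    by (intro sum.cong refl arg_cong[where f = "\<lambda>f. fps_nth f j"] pivot_term_eq_prod) auto
  finally show ?thesis .
qed

lemma finite_nonzero_pivot_sums:
  "finite {m\<in>{1..}. fps_nth (\<Sum>\<^sub>\<infinity>P\<in>pivot_chains c m. pivot_term m P) n \<noteq> 0}"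
proof (rule finite_subset)
  let ?B = "pivot_lists (empty_slice c) (full_slice c n)"
  show "finite (length ` ?B)" using finite_chains_full[of n] by (simp add: pivot_lists_def)
  show "{m\<in>{1..}. fps_nth (\<Sum>\<^sub>\<infinity>P\<in>pivot_chains c m. pivot_term m P) n \<noteq> 0} \<subseteq> length ` ?B"
  proof clarify
    fix m assume "fps_nth (\<Sum>\<^sub>\<infinity>P\<in>pivot_chains c m. pivot_term m P) n \<noteq> 0"
    then have "{P. P \<in> ?B \<and> length P = m} \<noteq> {}"
      unfolding pivot_term_nth_infsum[OF order_refl] by (metis (lifting) sum.empty)
    then show "m \<in> length ` ?B" by auto
  qed
qed

text \<open>The pivot lists below the top are grouped by their length \<open>m\<close>; the empty
  list is the summand 1.\<close>

lemma pivot_gf_cong: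
  assumes "k \<le> M"
  shows "fps_cong k (1 + (\<Sum>\<^sub>\<infinity>m\<in>{1..}. \<Sum>\<^sub>\<infinity>P\<in>pivot_chains c m. pivot_term m P))
    (\<Sum>P\<in>pivot_lists (empty_slice c) (full_slice c M). \<Prod>\<sigma>\<in>set P. pivot_weight_gf (weight \<sigma>))"
  unfolding fps_cong_def
proof (intro allI impI)
  fix j assume "j \<le> k"
  then have j: "j \<le> M" using assms by simp
  let ?B = "pivot_lists (empty_slice c) (full_slice c M)"
  let ?h = "\<lambda>P. \<Prod>\<sigma>\<in>set P. pivot_weight_gf (weight \<sigma>)"
  have finB: "finite ?B" using finite_chains_full[of M] by (simp add: pivot_lists_def)
  have nil: "[] \<in> ?B"
    using chains_full_iff[of "[]" M] by (auto simp: pivot_lists_def strict_slice_chain_def)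
  have "fps_nth (\<Sum>\<^sub>\<infinity>m\<in>{1..}. \<Sum>\<^sub>\<infinity>P\<in>pivot_chains c m. pivot_term m P) j =
      (\<Sum>m\<in>length ` (?B - {[]}). fps_nth (\<Sum>\<^sub>\<infinity>P\<in>pivot_chains c m. pivot_term m P) j)"
  proof (rule fps_infsum_nth[OF finite_nonzero_pivot_sums])
    show "finite (length ` (?B - {[]}))" using finB by simp
    show "length ` (?B - {[]}) \<subseteq> {1..}" by (auto simp: Suc_le_eq)
    fix m assume "m \<in> {1..} - length ` (?B - {[]})"
    then have "{P. P \<in> ?B \<and> length P = m} = {}" by force
    then show "fps_nth (\<Sum>\<^sub>\<infinity>P\<in>pivot_chains c m. pivot_term m P) j = 0"
      unfolding pivot_term_nth_infsum[OF j] by (simp only: sum.empty)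
  qed
  also have "\<dots> = (\<Sum>m\<in>length ` (?B - {[]}). \<Sum>P | P \<in> ?B - {[]} \<and> length P = m. fps_nth (?h P) j)"
    unfolding pivot_term_nth_infsum[OF j] by (intro sum.cong refl) auto
  also have "\<dots> = (\<Sum>P\<in>?B - {[]}. fps_nth (?h P) j)"
    using finB by (intro sum.group) auto
  finally show "fps_nth (1 + (\<Sum>\<^sub>\<infinity>m\<in>{1..}. \<Sum>\<^sub>\<infinity>P\<in>pivot_chains c m. pivot_term m P)) j =
      fps_nth (\<Sum>P\<in>?B. ?h P) j"
    unfolding fps_add_nth fps_sum_nth using sum.remove[OF finB nil, of "\<lambda>P. fps_nth (?h P) j"] by simp
qed

lemma qpoch_prod_reindex:
  fixes a :: zu_fps
  assumes "2 \<le> n"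
  shows "(\<Prod>i\<le>n - 2. 1 - a * qvar * qvar ^ i) = (\<Prod>m\<in>{0<..<n}. 1 - a * qvar ^ m)"
proof -
  have "{0<..<n} = Suc ` {..n - 2}"
    unfolding image_Suc_atMost using assms by auto
  then show ?thesis by (simp add: prod.reindex mult.assoc)
qed

text \<open>In each degree both sides reduce to finite products over the same weights and the same
  sum over pivot lists; the factors are matched weight by weight with
  \<open>one_plus_chain_weight_gf\<close>.\<close>

lemma qpoch_times_cylindric_gf:
  "qpoch_inf (zvar * qvar) *
    (\<Sum>\<^sub>\<infinity>\<Lambda>\<in>cylindric_partitions c. qvar ^ weight \<Lambda> * zvar ^ max_part \<Lambda> * uvar ^ st \<Lambda>) =
   qpoch_inf ((1 - uvar) * zvar * qvar) *
    (1 + (\<Sum>\<^sub>\<infinity>m\<in>{1..}. \<Sum>\<^sub>\<infinity>P\<in>pivot_chains c m. pivot_term m P))" (is "?q1 * ?L = ?q2 * ?R")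
proof (rule fps_ext)
  fix k
  \<comment> \<open>With \<open>Suc k\<close> the weight \<open>n\<close> of \<open>T\<close> is at
    least \<open>k + 2\<close>, so the weights strictly between 0 and \<open>n\<close> cover the
    product indices up to \<open>k\<close> that \<open>qpoch_inf_cong\<close> requires.\<close>
  define T where "T = full_slice c (Suc k)"
  define n where "n = weight T"
  define S where "S = (\<Sum>P\<in>pivot_lists (empty_slice c) T. \<Prod>\<sigma>\<in>set P. pivot_weight_gf (weight \<sigma>))"
  let ?I = "{0<..<n}"
  have n: "k + 2 \<le> n" using weight_full[OF c(1), of "Suc k"] by (simp add: n_def T_def)
  have L: "fps_cong k ?L ((\<Prod>m\<in>?I. 1 + chain_weight_gf m) * S)"
    unfolding n_def S_def T_def by (rule cylindric_gf_cong) simp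
  have R: "fps_cong k ?R S"
    unfolding S_def T_def by (rule pivot_gf_cong) simp
  have q: "fps_cong k (qpoch_inf (a * qvar)) (\<Prod>m\<in>?I. 1 - a * qvar ^ m)" for a :: zu_fps
    using qpoch_inf_cong[of "a * qvar" k "n - 2"] qpoch_prod_reindex[of n a] n by simp
  have "(\<Prod>m\<in>?I. 1 - zvar * qvar ^ m) * ((\<Prod>m\<in>?I. 1 + chain_weight_gf m) * S) =
      (\<Prod>m\<in>?I. (1 - zvar * qvar ^ m) * (1 + chain_weight_gf m)) * S"
    by (simp only: prod.distrib mult.assoc)
  also have "\<dots> = (\<Prod>m\<in>?I. 1 - (1 - uvar) * zvar * qvar ^ m) * S"
    by (intro arg_cong2[where f = "(*)"] prod.cong refl one_plus_chain_weight_gf) simp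
  finally have eq: "(\<Prod>m\<in>?I. 1 - zvar * qvar ^ m) * ((\<Prod>m\<in>?I. 1 + chain_weight_gf m) * S) =
      (\<Prod>m\<in>?I. 1 - (1 - uvar) * zvar * qvar ^ m) * S" .
  have "fps_cong k (?q1 * ?L) ((\<Prod>m\<in>?I. 1 - (1 - uvar) * zvar * qvar ^ m) * S)"
    unfolding eq[symmetric] by (rule fps_cong_mult[OF q L])
  moreover have "fps_cong k (?q2 * ?R) ((\<Prod>m\<in>?I. 1 - (1 - uvar) * zvar * qvar ^ m) * S)"
    by (rule fps_cong_mult[OF q R])
  ultimately show "fps_nth (?q1 * ?L) k = fps_nth (?q2 * ?R) k" by (simp add: fps_cong_def)
qed

end

theorem theorem4:
  fixes c :: "nat list"
  assumes "length c \<ge> 1" and "sum_list c \<ge> 1"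
  shows "(\<Sum>\<^sub>\<infinity>\<Lambda>\<in>cylindric_partitions c. qvar ^ weight \<Lambda> * zvar ^ max_part \<Lambda> * uvar ^ st \<Lambda>) =
    qpoch_inf ((1 - uvar) * zvar * qvar) * fps_recip (qpoch_inf (zvar * qvar)) *
    (1 + (\<Sum>\<^sub>\<infinity>m\<in>{1..}. \<Sum>\<^sub>\<infinity>P\<in>pivot_chains c m.
       \<Prod>j<m. uvar * zvar * qvar ^ weight (P ! j) *
         fps_recip (1 - (1 - uvar) * zvar * qvar ^ weight (P ! j))))"
  (is "?L = ?q2 * fps_recip ?q1 * ?R")
proof -
  have "?q1 * fps_recip ?q1 = 1"
    by (rule fps_mult_recip, rule qpoch_inf_convergent(2)) simp
  then have "?L = (?q1 * fps_recip ?q1) * ?L" by (simp only: mult_1_left)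
  also have "\<dots> = fps_recip ?q1 * (?q1 * ?L)" by (simp only: mult_ac)
  also have "?q1 * ?L = ?q2 * ?R" by (rule qpoch_times_cylindric_gf[OF assms])
  also have "fps_recip ?q1 * (?q2 * ?R) = ?q2 * fps_recip ?q1 * ?R" by (simp only: mult_ac)
  finally show ?thesis .
qed

end
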